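(* Assume that $\Sigma_g\times V_g$ admits an $M$-decomposition. Then $\Sigma_g\times(\nabla\cdot\Sigma_g)$ admits an $M$-decomposition provided that $\nabla\cdot\Sigma_g$ contains the space of rigid motions $RM(K)$.
   Context: $K\subset\mathbb R^n$ ($n=2,3$) is a polygonal/polyhedral element with outward unit normal (also denoted $n$) on $\partial K$; $\mathbb S$ is the space of real symmetric $n\times n$ matrices. $\Sigma_g$ is a finite-dimensional subspace of $\{\tau\in H(\mathrm{div},K;\mathbb S):\tau n|_{\partial K}\in L^2(\partial K)^n\}$, $V_g$ a finite-dimensional subspace of $H^1(K)^n$, $M$ a finite-dimensional subspace of $L^2(\partial K)^n$. $\epsilon(v)=\frac12(\nabla v+\nabla v^T)$; $\nabla\cdot\tau$ is the row-wise divergence; $\mathrm{tr}(\tau,v)=(\tau n+v)|_{\partial K}$; $RM(K)=\{v\in H^1(K)^n:\epsilon(v)=0\}$. $M$-decomposition: $\Sigma\times V$ admits an $M$-decomposition if $\mathrm{tr}(\Sigma\times V)\subset M$ and there exist subspaces $\widetilde\Sigma\subset\Sigma$, $\widetilde V\subset V$ with $\epsilon(V)\subset\widetilde\Sigma$, $\nabla\cdot\Sigma\subset\widetilde V$, such that $\mathrm{tr}:\widetilde\Sigma^\perp\times\widetilde V^\perp\to M$ is an isomorphism ($\perp$: $L^2(K)$-orthogonal complements in $\Sigma$ and $V$). *)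

theory Defs
  imports "HOL-Analysis.Analysis"
begin

section \<open>Elements and surface measure\<close>

text \<open>Convexity is not required; since the pieces are full-dimensional, the element is the closure
  of its interior.\<close>

definition polyhedral_element :: "(real ^ 'n) set \<Rightarrow> bool" where
  "polyhedral_element K \<longleftrightarrow>
     (\<exists>\<P>. finite \<P> \<and> \<P> \<noteq> {} \<and> (\<forall>P\<in>\<P>. polytope P \<and> interior P \<noteq> {}) \<and> K = \<Union>\<P>)
     \<and> connected (interior K)"

text \<open>The \<open>m\<close>-dimensional Hausdorff outer measure, \<open>m \<ge> 1\<close>, normalised so that it agrees with
  Lebesgue measure on \<open>m\<close>-dimensional planes. It is countably additive on the Borel sets, so that
  \<open>measure_of\<close> below is indeed its restriction to them (and not the null measure).\<close>

definition hausdorff_pre :: "nat \<Rightarrow> real \<Rightarrow> 'a::metric_space set \<Rightarrow> ennreal" where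
  "hausdorff_pre m \<delta> A =
     (INF C \<in> {C :: nat \<Rightarrow> 'a set. A \<subseteq> (\<Union>i. C i) \<and> (\<forall>i. bounded (C i) \<and> diameter (C i) \<le> \<delta>)}.
        \<Sum>i. ennreal (unit_ball_vol (real m) * (diameter (C i) / 2) ^ m))"

definition hausdorff_outer :: "nat \<Rightarrow> 'a::metric_space set \<Rightarrow> ennreal" where
  "hausdorff_outer m A = (SUP \<delta> \<in> {0<..}. hausdorff_pre m \<delta> A)"

definition boundary_measure :: "(real ^ 'n) set \<Rightarrow> (real ^ 'n) measure" where
  "boundary_measure K =
     restrict_space (measure_of UNIV (sets borel) (hausdorff_outer (CARD('n) - 1))) (frontier K)"

section \<open>Square-integrable functions and their subspaces\<close>

text \<open>Elements of \<open>L\<^sup>2(M)\<close> are represented by functions, and equality is equality almost everywhere.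
  A subspace of \<open>L\<^sup>2(M)\<close> is represented by the set of all representatives of its elements; hence the
  closure under almost-everywhere equality. For matrix-valued functions, the norm and the
  inner product of \<open>real ^ 'n ^ 'n\<close> are the Frobenius ones.\<close>

definition L2 :: "'a measure \<Rightarrow> ('a \<Rightarrow> 'b::euclidean_space) set" where
  "L2 M = {f \<in> borel_measurable M. integrable M (\<lambda>x. (norm (f x))\<^sup>2)}"

definition L2_inner :: "'a measure \<Rightarrow> ('a \<Rightarrow> 'b::euclidean_space) \<Rightarrow> ('a \<Rightarrow> 'b) \<Rightarrow> real" where
  "L2_inner M f g = (\<integral>x. f x \<bullet> g x \<partial>M)"

definition L2_tendsto ::
  "'a measure \<Rightarrow> (nat \<Rightarrow> 'a \<Rightarrow> 'b::euclidean_space) \<Rightarrow> ('a \<Rightarrow> 'b) \<Rightarrow> bool" where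
  "L2_tendsto M f g \<longleftrightarrow> (\<lambda>k. \<integral>\<^sup>+x. ennreal ((norm (f k x - g x))\<^sup>2) \<partial>M) \<longlonglongrightarrow> 0"

definition L2_subspace :: "'a measure \<Rightarrow> ('a \<Rightarrow> 'b::euclidean_space) set \<Rightarrow> bool" where
  "L2_subspace M S \<longleftrightarrow>
     S \<subseteq> L2 M \<and> (\<lambda>x. 0) \<in> S
     \<and> (\<forall>f\<in>S. \<forall>g\<in>S. (\<lambda>x. f x + g x) \<in> S)
     \<and> (\<forall>c. \<forall>f\<in>S. (\<lambda>x. c *\<^sub>R f x) \<in> S)
     \<and> (\<forall>f\<in>S. \<forall>g\<in>borel_measurable M. (AE x in M. f x = g x) \<longrightarrow> g \<in> S)"

definition L2_finite_dim :: "'a measure \<Rightarrow> ('a \<Rightarrow> 'b::euclidean_space) set \<Rightarrow> bool" where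
  "L2_finite_dim M S \<longleftrightarrow>
     (\<exists>B. finite B \<and> B \<subseteq> S \<and> (\<forall>f\<in>S. \<exists>c. AE x in M. f x = (\<Sum>b\<in>B. c b *\<^sub>R b x)))"

text \<open>Orthogonal complement of \<open>T\<close> in \<open>S\<close>.\<close>

definition L2_perp ::
  "'a measure \<Rightarrow> ('a \<Rightarrow> 'b::euclidean_space) set \<Rightarrow> ('a \<Rightarrow> 'b) set \<Rightarrow> ('a \<Rightarrow> 'b) set" where
  "L2_perp M S T = {f \<in> S. \<forall>g\<in>T. L2_inner M f g = 0}"

section \<open>Test functions and weak derivatives\<close>

primrec C_diff :: "nat \<Rightarrow> ('a::euclidean_space \<Rightarrow> 'b::real_normed_vector) \<Rightarrow> bool" where
  "C_diff 0 = (\<lambda>f. continuous_on UNIV f)"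
| "C_diff (Suc k) = (\<lambda>f. (\<forall>x. f differentiable (at x)) \<and>
      (\<forall>b\<in>Basis. C_diff k (\<lambda>x. frechet_derivative f (at x) b)))"

definition C_infinity :: "('a::euclidean_space \<Rightarrow> 'b::real_normed_vector) \<Rightarrow> bool" where
  "C_infinity f \<longleftrightarrow> (\<forall>k. C_diff k f)"

definition test_function :: "(real ^ 'n) set \<Rightarrow> (real ^ 'n \<Rightarrow> real) \<Rightarrow> bool" where
  "test_function K \<phi> \<longleftrightarrow>
     C_infinity \<phi> \<and> compact (closure {x. \<phi> x \<noteq> 0}) \<and> closure {x. \<phi> x \<noteq> 0} \<subseteq> interior K"

definition partial :: "'n \<Rightarrow> (real ^ 'n \<Rightarrow> real) \<Rightarrow> real ^ 'n \<Rightarrow> real" where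
  "partial j \<phi> x = frechet_derivative \<phi> (at x) (axis j 1)"

text \<open>Weak derivatives are unique only up to null sets, so they are relations between
  representatives. \<open>G $ i $ j\<close> is the derivative of the \<open>i\<close>-th component in direction \<open>j\<close>.\<close>

definition has_weak_gradient ::
  "(real ^ 'n) set \<Rightarrow> (real ^ 'n \<Rightarrow> real ^ 'n) \<Rightarrow> (real ^ 'n \<Rightarrow> real ^ 'n ^ 'n) \<Rightarrow> bool" where
  "has_weak_gradient K v G \<longleftrightarrow>
     v \<in> L2 (lebesgue_on K) \<and> G \<in> L2 (lebesgue_on K) \<and>
     (\<forall>i j \<phi>. test_function K \<phi> \<longrightarrow>
        (\<integral>x. v x $ i * partial j \<phi> x \<partial>lebesgue_on K)
          = - (\<integral>x. G x $ i $ j * \<phi> x \<partial>lebesgue_on K))"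

definition H1 :: "(real ^ 'n) set \<Rightarrow> (real ^ 'n \<Rightarrow> real ^ 'n) set" where
  "H1 K = {v. \<exists>G. has_weak_gradient K v G}"

definition has_weak_strain ::
  "(real ^ 'n) set \<Rightarrow> (real ^ 'n \<Rightarrow> real ^ 'n) \<Rightarrow> (real ^ 'n \<Rightarrow> real ^ 'n ^ 'n) \<Rightarrow> bool" where
  "has_weak_strain K v E \<longleftrightarrow>
     E \<in> L2 (lebesgue_on K) \<and>
     (\<exists>G. has_weak_gradient K v G \<and>
        (AE x in lebesgue_on K. E x = (1 / 2) *\<^sub>R (G x + transpose (G x))))"

definition has_weak_div ::
  "(real ^ 'n) set \<Rightarrow> (real ^ 'n \<Rightarrow> real ^ 'n ^ 'n) \<Rightarrow> (real ^ 'n \<Rightarrow> real ^ 'n) \<Rightarrow> bool" where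
  "has_weak_div K \<tau> d \<longleftrightarrow>
     \<tau> \<in> L2 (lebesgue_on K) \<and> d \<in> L2 (lebesgue_on K) \<and>
     (\<forall>i \<phi>. test_function K \<phi> \<longrightarrow>
        (\<integral>x. (\<Sum>j\<in>UNIV. \<tau> x $ i $ j * partial j \<phi> x) \<partial>lebesgue_on K)
          = - (\<integral>x. d x $ i * \<phi> x \<partial>lebesgue_on K))"

definition Hdiv_sym :: "(real ^ 'n) set \<Rightarrow> (real ^ 'n \<Rightarrow> real ^ 'n ^ 'n) set" where
  "Hdiv_sym K =
     {\<tau>. (\<exists>d. has_weak_div K \<tau> d) \<and> (AE x in lebesgue_on K. transpose (\<tau> x) = \<tau> x)}"

definition strain_image ::
  "(real ^ 'n) set \<Rightarrow> (real ^ 'n \<Rightarrow> real ^ 'n) set \<Rightarrow> (real ^ 'n \<Rightarrow> real ^ 'n ^ 'n) set" where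
  "strain_image K V = {E. \<exists>v\<in>V. has_weak_strain K v E}"

definition div_image ::
  "(real ^ 'n) set \<Rightarrow> (real ^ 'n \<Rightarrow> real ^ 'n ^ 'n) set \<Rightarrow> (real ^ 'n \<Rightarrow> real ^ 'n) set" where
  "div_image K \<Sigma> = {d. \<exists>\<tau>\<in>\<Sigma>. has_weak_div K \<tau> d}"

definition rigid_motions :: "(real ^ 'n) set \<Rightarrow> (real ^ 'n \<Rightarrow> real ^ 'n) set" where
  "rigid_motions K = {v \<in> H1 K. has_weak_strain K v (\<lambda>x. 0)}"

section \<open>Traces\<close>

text \<open>The trace on \<open>H\<^sup>1(K)\<close> is the continuous extension of the restriction
  \<open>\<phi> \<mapsto> \<phi>|\<partial>K\<close> from smooth functions. It exists for every element of \<open>H\<^sup>1(K)\<close>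
  and is unique almost everywhere on the boundary.\<close>

definition has_trace ::
  "(real ^ 'n) set \<Rightarrow> (real ^ 'n \<Rightarrow> real ^ 'n) \<Rightarrow> (real ^ 'n \<Rightarrow> real ^ 'n) \<Rightarrow> bool" where
  "has_trace K v g \<longleftrightarrow>
     g \<in> L2 (boundary_measure K) \<and>
     (\<exists>G \<phi>. has_weak_gradient K v G \<and> (\<forall>k. C_infinity (\<phi> k)) \<and>
        L2_tendsto (lebesgue_on K) \<phi> v \<and>
        L2_tendsto (lebesgue_on K) (\<lambda>k x. jacobian (\<phi> k) (at x)) G \<and>
        L2_tendsto (boundary_measure K) \<phi> g)"

text \<open>The normal trace \<open>\<tau>n\<close> (with \<open>n\<close> the outward unit normal) of a field in \<open>H(div)\<close> is a
  functional given by Green's formula; the following says that it is represented by the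
  square-integrable function \<open>g\<close>.\<close>

definition has_normal_trace ::
  "(real ^ 'n) set \<Rightarrow> (real ^ 'n \<Rightarrow> real ^ 'n ^ 'n) \<Rightarrow> (real ^ 'n \<Rightarrow> real ^ 'n) \<Rightarrow> bool" where
  "has_normal_trace K \<tau> g \<longleftrightarrow>
     g \<in> L2 (boundary_measure K) \<and>
     (\<exists>d. has_weak_div K \<tau> d \<and>
        (\<forall>\<phi>. C_infinity \<phi> \<longrightarrow>
           has_bochner_integral (boundary_measure K) (\<lambda>x. g x \<bullet> \<phi> x)
             ((\<integral>x. d x \<bullet> \<phi> x \<partial>lebesgue_on K)
               + (\<integral>x. \<tau> x \<bullet> jacobian \<phi> (at x) \<partial>lebesgue_on K))))"

definition has_tr ::
  "(real ^ 'n) set \<Rightarrow> (real ^ 'n \<Rightarrow> real ^ 'n ^ 'n) \<Rightarrow> (real ^ 'n \<Rightarrow> real ^ 'n)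
     \<Rightarrow> (real ^ 'n \<Rightarrow> real ^ 'n) \<Rightarrow> bool" where
  "has_tr K \<tau> v \<mu> \<longleftrightarrow>
     \<mu> \<in> borel_measurable (boundary_measure K) \<and>
     (\<exists>g h. has_normal_trace K \<tau> g \<and> has_trace K v h \<and>
        (AE x in boundary_measure K. \<mu> x = g x + h x))"

section \<open>M-decompositions\<close>

definition stress_space :: "(real ^ 'n) set \<Rightarrow> (real ^ 'n \<Rightarrow> real ^ 'n ^ 'n) set \<Rightarrow> bool" where
  "stress_space K \<Sigma> \<longleftrightarrow>
     L2_subspace (lebesgue_on K) \<Sigma> \<and> L2_finite_dim (lebesgue_on K) \<Sigma> \<and>
     \<Sigma> \<subseteq> {\<tau> \<in> Hdiv_sym K. \<exists>g. has_normal_trace K \<tau> g}"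

definition displacement_space :: "(real ^ 'n) set \<Rightarrow> (real ^ 'n \<Rightarrow> real ^ 'n) set \<Rightarrow> bool" where
  "displacement_space K V \<longleftrightarrow>
     L2_subspace (lebesgue_on K) V \<and> L2_finite_dim (lebesgue_on K) V \<and> V \<subseteq> H1 K"

definition trace_space :: "(real ^ 'n) set \<Rightarrow> (real ^ 'n \<Rightarrow> real ^ 'n) set \<Rightarrow> bool" where
  "trace_space K M \<longleftrightarrow>
     L2_subspace (boundary_measure K) M \<and> L2_finite_dim (boundary_measure K) M"

text \<open>The relation \<open>has_tr\<close>, read modulo almost-everywhere equality, is the graph of a linear
  bijection from \<open>A \<times> B\<close> onto \<open>M\<close>. The conjuncts say: everywhere defined, single-valued, linear,
  injective, surjective.\<close>

definition tr_isomorphism ::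
  "(real ^ 'n) set \<Rightarrow> (real ^ 'n \<Rightarrow> real ^ 'n ^ 'n) set \<Rightarrow> (real ^ 'n \<Rightarrow> real ^ 'n) set
     \<Rightarrow> (real ^ 'n \<Rightarrow> real ^ 'n) set \<Rightarrow> bool" where
  "tr_isomorphism K A B M \<longleftrightarrow>
     (\<forall>\<tau>\<in>A. \<forall>v\<in>B. \<exists>\<mu>\<in>M. has_tr K \<tau> v \<mu>) \<and>
     (\<forall>\<tau>\<in>A. \<forall>v\<in>B. \<forall>\<mu> \<mu>'. has_tr K \<tau> v \<mu> \<longrightarrow> has_tr K \<tau> v \<mu>' \<longrightarrow>
        (AE x in boundary_measure K. \<mu> x = \<mu>' x)) \<and>
     (\<forall>\<tau>\<in>A. \<forall>\<tau>'\<in>A. \<forall>v\<in>B. \<forall>v'\<in>B. \<forall>\<mu> \<mu>' a b.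
        has_tr K \<tau> v \<mu> \<longrightarrow> has_tr K \<tau>' v' \<mu>' \<longrightarrow>
        has_tr K (\<lambda>x. a *\<^sub>R \<tau> x + b *\<^sub>R \<tau>' x) (\<lambda>x. a *\<^sub>R v x + b *\<^sub>R v' x)
          (\<lambda>x. a *\<^sub>R \<mu> x + b *\<^sub>R \<mu>' x)) \<and>
     (\<forall>\<tau>\<in>A. \<forall>\<tau>'\<in>A. \<forall>v\<in>B. \<forall>v'\<in>B. \<forall>\<mu>. has_tr K \<tau> v \<mu> \<longrightarrow> has_tr K \<tau>' v' \<mu> \<longrightarrow>
        (AE x in lebesgue_on K. \<tau> x = \<tau>' x) \<and> (AE x in lebesgue_on K. v x = v' x)) \<and>
     (\<forall>\<mu>\<in>M. \<exists>\<tau>\<in>A. \<exists>v\<in>B. has_tr K \<tau> v \<mu>)"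

definition admits_M_decomposition ::
  "(real ^ 'n) set \<Rightarrow> (real ^ 'n \<Rightarrow> real ^ 'n) set
     \<Rightarrow> (real ^ 'n \<Rightarrow> real ^ 'n ^ 'n) set \<Rightarrow> (real ^ 'n \<Rightarrow> real ^ 'n) set \<Rightarrow> bool" where
  "admits_M_decomposition K M \<Sigma> V \<longleftrightarrow>
     (\<forall>\<tau>\<in>\<Sigma>. \<forall>v\<in>V. (\<exists>\<mu>. has_tr K \<tau> v \<mu>) \<and> (\<forall>\<mu>. has_tr K \<tau> v \<mu> \<longrightarrow> \<mu> \<in> M)) \<and>
     (\<exists>\<Sigma>t Vt.
        L2_subspace (lebesgue_on K) \<Sigma>t \<and> \<Sigma>t \<subseteq> \<Sigma> \<and>
        L2_subspace (lebesgue_on K) Vt \<and> Vt \<subseteq> V \<and>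
        strain_image K V \<subseteq> \<Sigma>t \<and> div_image K \<Sigma> \<subseteq> Vt \<and>
        tr_isomorphism K (L2_perp (lebesgue_on K) \<Sigma> \<Sigma>t) (L2_perp (lebesgue_on K) V Vt) M)"

end

theory Submission
  imports Defs
begin

text \<open>Put \<open>V = \<nabla> \<cdot> \<Sigma>\<^sub>g\<close>, let \<open>A\<close> be the orthogonal complement of \<open>\<epsilon>(V)\<close> in \<open>\<Sigma>\<^sub>g\<close> and
  \<open>Z = {\<tau> \<in> A. \<tau> n = 0}\<close>. The new decomposition has \<open>V\<close> itself as its second space and
  \<open>\<epsilon>(V) + Z\<close> as its first one, whose complement is the complement of \<open>Z\<close> in \<open>A\<close>. It remains to see
  that the normal traces of \<open>A\<close> fill \<open>M\<close>. If \<open>m \<in> M\<close> is orthogonal to all of them, then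
  \<open>\<langle>\<tau> n, m\<rangle> = (\<tau>, \<epsilon>(u))\<close> on \<open>\<Sigma>\<^sub>g\<close> for some \<open>u \<in> V\<close>. Write \<open>m = \<sigma> n + w\<close> by the given
  decomposition. Green's formula gives \<open>\<langle>\<tau> n, w\<rangle> = (\<tau>, \<epsilon>(w))\<close>, as \<open>w\<close> is orthogonal to all
  divergences. Taking \<open>\<tau> = \<sigma>\<close> yields \<open>\<sigma> n = 0\<close>, whence \<open>\<epsilon>(w) = \<epsilon>(u)\<close>. So \<open>w - u\<close> is
  a rigid motion, \<open>w\<close> lies in \<open>V\<close>, and being orthogonal to \<open>V\<close> it vanishes.\<close>

section \<open>Square-integrable functions\<close>

lemma L2_measurable: "f \<in> L2 M \<Longrightarrow> f \<in> borel_measurable M"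
  by (simp add: L2_def)

text \<open>The parallelogram law with the term for \<open>u - v\<close> dropped. It plays the role
  of the triangle inequality for squared norms, which can be integrated termwise.\<close>

lemma norm_add_square_le: "(norm (u + v :: 'a::real_inner))\<^sup>2 \<le> 2 * (norm u)\<^sup>2 + 2 * (norm v)\<^sup>2"
proof -
  have "(norm (u + v))\<^sup>2 + (norm (u - v))\<^sup>2 = 2 * (norm u)\<^sup>2 + 2 * (norm v)\<^sup>2"
    by (simp add: power2_norm_eq_inner algebra_simps)
  then show ?thesis
    using zero_le_power2[of "norm (u - v)"] by linarith
qed

lemma L2_lincomb:
  assumes "f \<in> L2 M" "g \<in> L2 M"
  shows "(\<lambda>x. a *\<^sub>R f x + b *\<^sub>R g x) \<in> L2 M"
proof -
  have [measurable]: "f \<in> borel_measurable M" "g \<in> borel_measurable M"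
    using assms by (auto simp: L2_def)
  have "integrable M (\<lambda>x. 2 * a\<^sup>2 * (norm (f x))\<^sup>2 + 2 * b\<^sup>2 * (norm (g x))\<^sup>2)"
    using assms by (intro Bochner_Integration.integrable_add integrable_mult_right) (auto simp: L2_def)
  moreover have "(norm (a *\<^sub>R f x + b *\<^sub>R g x))\<^sup>2 \<le> 2 * a\<^sup>2 * (norm (f x))\<^sup>2 + 2 * b\<^sup>2 * (norm (g x))\<^sup>2" for x
    using norm_add_square_le[of "a *\<^sub>R f x" "b *\<^sub>R g x"] by (simp add: power_mult_distrib)
  ultimately have "integrable M (\<lambda>x. (norm (a *\<^sub>R f x + b *\<^sub>R g x))\<^sup>2)"
    by (auto intro: Bochner_Integration.integrable_bound)
  then show ?thesis
    by (simp add: L2_def)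
qed

lemma L2_diff: "f \<in> L2 M \<Longrightarrow> g \<in> L2 M \<Longrightarrow> (\<lambda>x. f x - g x) \<in> L2 M"
  using L2_lincomb[of f M g 1 "-1"] by simp

text \<open>By Cauchy-Schwarz and the inequality between geometric and arithmetic mean, the product
  is dominated pointwise by the sum of the two integrable squares.\<close>

lemma L2_integrable_inner:
  assumes "f \<in> L2 M" "g \<in> L2 M"
  shows "integrable M (\<lambda>x. f x \<bullet> g x)"
proof -
  have [measurable]: "f \<in> borel_measurable M" "g \<in> borel_measurable M"
    using assms by (auto simp: L2_def)
  have *: "\<bar>f x \<bullet> g x\<bar> \<le> (norm (f x))\<^sup>2 + (norm (g x))\<^sup>2" for x
  proof -
    have "2 * (norm (f x) * norm (g x)) \<le> (norm (f x))\<^sup>2 + (norm (g x))\<^sup>2"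
      using sum_squares_bound[of "norm (f x)" "norm (g x)"] by simp
    moreover have "0 \<le> norm (f x) * norm (g x)"
      by simp
    ultimately show ?thesis
      using Cauchy_Schwarz_ineq2[of "f x" "g x"] by linarith
  qed
  have "integrable M (\<lambda>x. (norm (f x))\<^sup>2 + (norm (g x))\<^sup>2)"
    using assms by (auto simp: L2_def)
  then show ?thesis
  proof (rule Bochner_Integration.integrable_bound)
    show "AE x in M. norm (f x \<bullet> g x) \<le> norm ((norm (f x))\<^sup>2 + (norm (g x))\<^sup>2)"
      using * by simp
  qed measurable
qed

text \<open>The components are again in a general Euclidean space, so that one application to a
  matrix field gives its rows and a second one its entries.\<close>

lemma L2_nth:
  fixes f :: "'a \<Rightarrow> 'b::euclidean_space ^ 'n"
  assumes "f \<in> L2 M"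
  shows "(\<lambda>x. f x $ i) \<in> L2 M"
proof -
  have [measurable]: "f \<in> borel_measurable M"
    using assms by (auto simp: L2_def)
  have m: "(\<lambda>x. f x $ i) \<in> borel_measurable M"
    by (rule borel_measurable_continuous_on[OF _ \<open>f \<in> borel_measurable M\<close>, of "\<lambda>y. y $ i"])
      (intro continuous_intros)
  have "integrable M (\<lambda>x. (norm (f x $ i))\<^sup>2)"
  proof (rule Bochner_Integration.integrable_bound)
    show "integrable M (\<lambda>x. (norm (f x))\<^sup>2)"
      using assms by (simp add: L2_def)
    show "AE x in M. norm ((norm (f x $ i))\<^sup>2) \<le> norm ((norm (f x))\<^sup>2)"
      by (auto intro!: power_mono Finite_Cartesian_Product.norm_nth_le)
    show "(\<lambda>x. (norm (f x $ i))\<^sup>2) \<in> borel_measurable M"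
      using m by measurable
  qed
  with m show ?thesis
    by (simp add: L2_def)
qed

lemma L2_cong_AE:
  assumes "f \<in> L2 M" "g \<in> borel_measurable M" "AE x in M. f x = g x"
  shows "g \<in> L2 M"
proof -
  have [measurable]: "f \<in> borel_measurable M" "g \<in> borel_measurable M"
    using assms by (auto simp: L2_def)
  have "integrable M (\<lambda>x. (norm (f x))\<^sup>2) = integrable M (\<lambda>x. (norm (g x))\<^sup>2)"
    by (rule integrable_cong_AE) (use assms(3) in auto)
  then show ?thesis
    using assms by (simp add: L2_def)
qed

lemma L2_inner_commute: "L2_inner M f g = L2_inner M g f"
  by (simp add: L2_inner_def inner_commute)

lemma L2_inner_lincomb:
  assumes "f \<in> L2 M" "g \<in> L2 M" "h \<in> L2 M"
  shows "L2_inner M (\<lambda>x. a *\<^sub>R f x + b *\<^sub>R g x) h = a * L2_inner M f h + b * L2_inner M g h"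
  using assms by (simp add: L2_inner_def inner_add_left L2_integrable_inner)

lemma L2_inner_diff:
  assumes "f \<in> L2 M" "g \<in> L2 M" "h \<in> L2 M"
  shows "L2_inner M (\<lambda>x. f x - g x) h = L2_inner M f h - L2_inner M g h"
  using L2_inner_lincomb[OF assms, of 1 "-1"] by simp

lemma L2_inner_cong_AE:
  assumes "f \<in> L2 M" "f' \<in> L2 M" "g \<in> L2 M" "AE x in M. f x = f' x"
  shows "L2_inner M f g = L2_inner M f' g"
proof -
  have [measurable]: "f \<in> borel_measurable M" "g \<in> borel_measurable M" "f' \<in> borel_measurable M"
    using assms by (auto simp: L2_def)
  show ?thesis
    unfolding L2_inner_def by (rule integral_cong_AE) (use assms(4) in auto)
qed

lemma L2_inner_self_eq_0:
  assumes "f \<in> L2 M" "L2_inner M f f = 0"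
  shows "AE x in M. f x = 0"
proof -
  have "AE x in M. f x \<bullet> f x = 0"
    using assms integral_nonneg_eq_0_iff_AE[of M "\<lambda>x. f x \<bullet> f x"] L2_integrable_inner[of f M f]
    by (auto simp: L2_inner_def)
  then show ?thesis
    by simp
qed

lemma L2_inner_AE_0:
  assumes "f \<in> L2 M" "g \<in> L2 M" "AE x in M. f x = 0"
  shows "L2_inner M f g = 0"
  unfolding L2_inner_def by (rule integral_eq_zero_AE) (use assms(3) in auto)

text \<open>Cauchy-Schwarz bounds the squared difference of the inner products by
  \<open>G * N k\<close>, the squared norm of \<open>g\<close> times the squared distance from
  \<open>\<phi> k\<close> to \<open>h\<close>. This is what carries Green's formula from smooth
  functions over to traces.\<close>

lemma L2_tendsto_inner:
  assumes g: "g \<in> L2 M" and h: "h \<in> L2 M" and m: "\<And>k. \<phi> k \<in> borel_measurable M"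
    and lim: "L2_tendsto M \<phi> h"
  shows "(\<lambda>k. L2_inner M g (\<phi> k)) \<longlonglongrightarrow> L2_inner M g h"
proof -
  have [measurable]: "g \<in> borel_measurable M" "h \<in> borel_measurable M" "\<phi> k \<in> borel_measurable M" for k
    using g h m by (auto simp: L2_def)
  define N where "N k = (\<integral>\<^sup>+x. ennreal ((norm (\<phi> k x - h x))\<^sup>2) \<partial>M)" for k
  define G where "G = (\<integral>\<^sup>+x. ennreal ((norm (g x))\<^sup>2) \<partial>M)"
  have N0: "N \<longlonglongrightarrow> 0"
    using lim by (simp add: L2_tendsto_def N_def[abs_def])
  have Gfin: "G < \<infinity>"
    using g unfolding L2_def integrable_iff_bounded G_def by simp
  \<comment> \<open>The bound 1 stands for any finite one: a finite distance puts
    \<open>\<phi> k - h\<close> into \<open>L2 M\<close>, and with it \<open>\<phi> k\<close>, which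
    is only assumed to be measurable.\<close>
  have "eventually (\<lambda>k. N k < 1) sequentially"
    using N0 by (rule order_tendstoD) simp
  then have ev: "eventually (\<lambda>k. ennreal ((L2_inner M g (\<phi> k) - L2_inner M g h)\<^sup>2) \<le> G * N k) sequentially"
  proof eventually_elim
    case (elim k)
    then have "N k < \<infinity>"
      by (simp add: less_top order_less_trans[OF _ ennreal_one_less_top])
    then have e: "(\<lambda>x. \<phi> k x - h x) \<in> L2 M"
      unfolding L2_def integrable_iff_bounded N_def by simp
    have "(\<lambda>x. 1 *\<^sub>R (\<phi> k x - h x) + 1 *\<^sub>R h x) \<in> L2 M"
      by (rule L2_lincomb[OF e h])
    then have p: "\<phi> k \<in> L2 M"
      by simp
    have "L2_inner M g (\<phi> k) - L2_inner M g h = L2_inner M g (\<lambda>x. \<phi> k x - h x)"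
      using L2_inner_diff[OF p h g] by (simp add: L2_inner_commute)
    then have "ennreal ((L2_inner M g (\<phi> k) - L2_inner M g h)\<^sup>2)
        = (ennreal (norm (\<integral>x. g x \<bullet> (\<phi> k x - h x) \<partial>M)))\<^sup>2"
      by (simp add: L2_inner_def ennreal_power)
    also have "\<dots> \<le> (\<integral>\<^sup>+x. ennreal (norm (g x \<bullet> (\<phi> k x - h x))) \<partial>M)\<^sup>2"
      by (intro power_mono integral_norm_bound_ennreal L2_integrable_inner g e) simp
    also have "\<dots> \<le> (\<integral>\<^sup>+x. ennreal (norm (g x)) * ennreal (norm (\<phi> k x - h x)) \<partial>M)\<^sup>2"
      by (intro power_mono nn_integral_mono)
        (auto simp: ennreal_mult[symmetric] Cauchy_Schwarz_ineq2)
    also have "\<dots> \<le> (\<integral>\<^sup>+x. ennreal (norm (g x)) ^ 2 \<partial>M) * (\<integral>\<^sup>+x. ennreal (norm (\<phi> k x - h x)) ^ 2 \<partial>M)"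
      by (rule Cauchy_Schwarz_nn_integral) auto
    finally show ?case
      by (simp add: G_def N_def ennreal_power)
  qed
  \<comment> \<open>Finiteness of \<open>G\<close> matters here: multiplication by infinity is not
    continuous at 0 on the extended nonnegative reals.\<close>
  have "(\<lambda>k. G * N k) \<longlonglongrightarrow> G * 0"
    using Gfin N0 by (intro ennreal_tendsto_cmult) simp_all
  then have "(\<lambda>k. ennreal ((L2_inner M g (\<phi> k) - L2_inner M g h)\<^sup>2)) \<longlonglongrightarrow> ennreal 0"
    by (intro tendsto_sandwich[OF _ ev tendsto_const]) auto
  then have "(\<lambda>k. (L2_inner M g (\<phi> k) - L2_inner M g h)\<^sup>2) \<longlonglongrightarrow> 0"
    by (rule tendsto_ennrealD) auto
  then have "(\<lambda>k. L2_inner M g (\<phi> k) - L2_inner M g h) \<longlonglongrightarrow> 0"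
    by simp
  then show ?thesis
    by (simp add: LIM_zero_iff)
qed

lemma L2_tendsto_lincomb:
  assumes [measurable]: "f \<in> borel_measurable M" "g \<in> borel_measurable M"
      "\<And>k. \<phi> k \<in> borel_measurable M" "\<And>k. \<psi> k \<in> borel_measurable M"
    and "L2_tendsto M \<phi> f" "L2_tendsto M \<psi> g"
  shows "L2_tendsto M (\<lambda>k x. a *\<^sub>R \<phi> k x + b *\<^sub>R \<psi> k x) (\<lambda>x. a *\<^sub>R f x + b *\<^sub>R g x)"
proof -
  define N where "N k = (\<integral>\<^sup>+x. ennreal ((norm (\<phi> k x - f x))\<^sup>2) \<partial>M)" for k
  define N' where "N' k = (\<integral>\<^sup>+x. ennreal ((norm (\<psi> k x - g x))\<^sup>2) \<partial>M)" for k
  have le: "(\<integral>\<^sup>+x. ennreal ((norm (a *\<^sub>R \<phi> k x + b *\<^sub>R \<psi> k x - (a *\<^sub>R f x + b *\<^sub>R g x)))\<^sup>2) \<partial>M)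
      \<le> ennreal (2 * a\<^sup>2) * N k + ennreal (2 * b\<^sup>2) * N' k" for k
  proof -
    have "(norm (a *\<^sub>R \<phi> k x + b *\<^sub>R \<psi> k x - (a *\<^sub>R f x + b *\<^sub>R g x)))\<^sup>2
      \<le> 2 * a\<^sup>2 * (norm (\<phi> k x - f x))\<^sup>2 + 2 * b\<^sup>2 * (norm (\<psi> k x - g x))\<^sup>2" for x
      using norm_add_square_le[of "a *\<^sub>R (\<phi> k x - f x)" "b *\<^sub>R (\<psi> k x - g x)"]
      unfolding norm_scaleR power_mult_distrib power2_abs by (simp add: algebra_simps)

    then have "(\<integral>\<^sup>+x. ennreal ((norm (a *\<^sub>R \<phi> k x + b *\<^sub>R \<psi> k x - (a *\<^sub>R f x + b *\<^sub>R g x)))\<^sup>2) \<partial>M)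
      \<le> (\<integral>\<^sup>+x. ennreal (2 * a\<^sup>2) * ennreal ((norm (\<phi> k x - f x))\<^sup>2)
          + ennreal (2 * b\<^sup>2) * ennreal ((norm (\<psi> k x - g x))\<^sup>2) \<partial>M)"
      by (intro nn_integral_mono) (simp add: ennreal_mult[symmetric] ennreal_plus[symmetric] del: ennreal_plus)
    also have "\<dots> = ennreal (2 * a\<^sup>2) * N k + ennreal (2 * b\<^sup>2) * N' k"
      by (simp add: nn_integral_add nn_integral_cmult N_def N'_def)
    finally show ?thesis .
  qed
  have "(\<lambda>k. ennreal (2 * a\<^sup>2) * N k + ennreal (2 * b\<^sup>2) * N' k) \<longlonglongrightarrow> ennreal (2 * a\<^sup>2) * 0 + ennreal (2 * b\<^sup>2) * 0"
    using assms(5,6) unfolding L2_tendsto_def N_def N'_def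
    by (intro tendsto_add ennreal_tendsto_cmult) auto
  then have "(\<lambda>k. ennreal (2 * a\<^sup>2) * N k + ennreal (2 * b\<^sup>2) * N' k) \<longlonglongrightarrow> 0"
    by simp
  then show ?thesis
    unfolding L2_tendsto_def
    by (rule tendsto_sandwich[OF _ _ tendsto_const, rotated 2]) (auto simp: le)
qed

section \<open>Orthogonal projection onto finite-dimensional subspaces\<close>

lemma L2_subspace_zero: "L2_subspace M S \<Longrightarrow> (\<lambda>x. 0) \<in> S"
  by (simp add: L2_subspace_def)

lemma L2_subspace_lincomb:
  "L2_subspace M S \<Longrightarrow> f \<in> S \<Longrightarrow> g \<in> S \<Longrightarrow> (\<lambda>x. a *\<^sub>R f x + b *\<^sub>R g x) \<in> S"
  by (simp add: L2_subspace_def)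

lemma L2_subspace_diff:
  "L2_subspace M S \<Longrightarrow> f \<in> S \<Longrightarrow> g \<in> S \<Longrightarrow> (\<lambda>x. f x - g x) \<in> S"
  using L2_subspace_lincomb[of M S f g 1 "-1"] by simp

lemma L2_subspace_cong_AE:
  "L2_subspace M S \<Longrightarrow> f \<in> S \<Longrightarrow> g \<in> borel_measurable M \<Longrightarrow> AE x in M. f x = g x \<Longrightarrow> g \<in> S"
  by (auto simp: L2_subspace_def)

text \<open>Closure under sums and multiples is merged into one condition, the form in which
  linearity of weak derivatives and traces is proved. The two are recovered with coefficients
  \<open>1, 1\<close> and with second coefficient \<open>0\<close>.\<close>

lemma L2_subspaceI:
  assumes "S \<subseteq> L2 M" "(\<lambda>x. 0) \<in> S"
    and lin: "\<And>f g a b. f \<in> S \<Longrightarrow> g \<in> S \<Longrightarrow> (\<lambda>x. a *\<^sub>R f x + b *\<^sub>R g x) \<in> S"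
    and "\<And>f g. f \<in> S \<Longrightarrow> g \<in> borel_measurable M \<Longrightarrow> AE x in M. f x = g x \<Longrightarrow> g \<in> S"
  shows "L2_subspace M S"
  unfolding L2_subspace_def
  using assms(1,2,4) lin[of _ _ 1 1] lin[of _ _ _ 0] by auto

lemma L2_subspace_perp:
  assumes S: "L2_subspace M S" and T: "T \<subseteq> L2 M"
  shows "L2_subspace M (L2_perp M S T)"
proof (rule L2_subspaceI)
  have SL: "S \<subseteq> L2 M"
    using S by (simp add: L2_subspace_def)
  show "L2_perp M S T \<subseteq> L2 M"
    using SL by (auto simp: L2_perp_def)
  show "(\<lambda>x. 0) \<in> L2_perp M S T"
    using L2_subspace_zero[OF S] by (auto simp: L2_perp_def L2_inner_def)
  show "(\<lambda>x. a *\<^sub>R f x + b *\<^sub>R g x) \<in> L2_perp M S T"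
    if "f \<in> L2_perp M S T" "g \<in> L2_perp M S T" for f g a b
    using that SL T L2_subspace_lincomb[OF S, of f g a b]
    by (auto simp: L2_perp_def L2_inner_lincomb subset_iff)
  show "g \<in> L2_perp M S T"
    if "f \<in> L2_perp M S T" "g \<in> borel_measurable M" "AE x in M. f x = g x" for f g
  proof -
    have g: "g \<in> S"
      using L2_subspace_cong_AE[OF S _ that(2,3)] that(1) by (auto simp: L2_perp_def)
    have "L2_inner M g t = L2_inner M f t" if "t \<in> T" for t
      using L2_inner_cong_AE[of f M g t] \<open>AE x in M. f x = g x\<close> \<open>f \<in> L2_perp M S T\<close> g SL T that
      by (auto simp: L2_perp_def)
    then show ?thesis
      using g that(1) by (auto simp: L2_perp_def)
  qed
qed

text \<open>Induction on the generators with a Gram-Schmidt step. The set \<open>B\<close> may lie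
  outside \<open>T\<close>, so that generators of a large space serve for all its subspaces and no
  basis of \<open>T\<close> has to be constructed. The subspace \<open>T\<close> varies in the
  induction, as it shrinks when a generator is removed.\<close>

lemma L2_projection_spanned:
  fixes T :: "('a \<Rightarrow> 'b::euclidean_space) set"
  assumes "finite B" "B \<subseteq> L2 M" "L2_subspace M T"
    and "\<And>t. t \<in> T \<Longrightarrow> \<exists>c. AE x in M. t x = (\<Sum>b\<in>B. c b *\<^sub>R b x)"
    and "f \<in> L2 M"
  shows "\<exists>p\<in>T. \<forall>t\<in>T. L2_inner M (\<lambda>x. f x - p x) t = 0"
  using assms
proof (induction B arbitrary: T f rule: finite_induct)
  case empty
  then have TL: "T \<subseteq> L2 M"
    by (simp add: L2_subspace_def)
  have "L2_inner M (\<lambda>x. f x - 0) t = 0" if t: "t \<in> T" for t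
  proof -
    have "AE x in M. t x = 0"
      using empty.prems(3)[OF t] by simp
    then have "L2_inner M t f = 0"
      by (rule L2_inner_AE_0[rotated 2]) (use t TL empty.prems in auto)
    then show ?thesis
      by (simp add: L2_inner_commute)
  qed
  then show ?case
    using L2_subspace_zero[OF empty.prems(2)] by (intro bexI[of _ "\<lambda>x. 0"]) auto
next
  case (insert b0 B)
  define sp where "sp t c \<longleftrightarrow> (AE x in M. t x = (\<Sum>b\<in>B. c b *\<^sub>R b x))" for t c
  \<comment> \<open>The elements of \<open>T\<close> that are generated without \<open>b0\<close>.
    Either this is all of \<open>T\<close>, or \<open>T\<close> exceeds it by one dimension,
    represented by \<open>t1\<close>.\<close>
  define T0 where "T0 = {t\<in>T. \<exists>c. sp t c}"
  note T = \<open>L2_subspace M T\<close>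
  have TL: "T \<subseteq> L2 M"
    using T by (simp add: L2_subspace_def)
  have T0: "L2_subspace M T0"
  proof (rule L2_subspaceI)
    show "T0 \<subseteq> L2 M"
      using TL by (auto simp: T0_def)
    have "sp (\<lambda>x. 0) (\<lambda>_. 0)"
      by (simp add: sp_def)
    then show "(\<lambda>x. 0) \<in> T0"
      using L2_subspace_zero[OF T] by (auto simp: T0_def)
    show "(\<lambda>x. a *\<^sub>R f x + b *\<^sub>R g x) \<in> T0" if fg: "f \<in> T0" "g \<in> T0" for f g a b
    proof -
      obtain c d where c: "sp f c" and d: "sp g d"
        using fg by (auto simp: T0_def)
      have "sp (\<lambda>x. a *\<^sub>R f x + b *\<^sub>R g x) (\<lambda>i. a * c i + b * d i)"
        using c d unfolding sp_def
        by eventually_elim (simp add: scaleR_sum_right sum.distrib scaleR_add_left)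
      then show ?thesis
        using that L2_subspace_lincomb[OF T, of f g a b] by (auto simp: T0_def)
    qed
    show "g \<in> T0" if "f \<in> T0" "g \<in> borel_measurable M" "AE x in M. f x = g x" for f g
    proof -
      obtain c where c: "sp f c"
        using \<open>f \<in> T0\<close> by (auto simp: T0_def)
      have "sp g c"
        using c that(3) unfolding sp_def by eventually_elim simp
      then show ?thesis
        using that L2_subspace_cong_AE[OF T, of f g] by (auto simp: T0_def)
    qed
  qed
  have IH: "\<exists>p\<in>T0. \<forall>t\<in>T0. L2_inner M (\<lambda>x. f x - p x) t = 0" if "f \<in> L2 M" for f
    by (rule insert.IH[OF _ T0 _ that]) (use insert.prems in \<open>auto simp: T0_def sp_def\<close>)
  show ?case
  proof (cases "T \<subseteq> T0")
    case True
    then have "T = T0"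
      by (auto simp: T0_def)
    then show ?thesis
      using IH[OF insert.prems(4)] by simp
  next
    case False
    then obtain t1 where t1: "t1 \<in> T" "t1 \<notin> T0"
      by auto
    obtain c1 where c1: "AE x in M. t1 x = (\<Sum>b\<in>insert b0 B. c1 b *\<^sub>R b x)"
      using insert.prems(3)[OF t1(1)] by auto
    have c10: "c1 b0 \<noteq> 0"
    proof
      assume "c1 b0 = 0"
      then have "sp t1 c1"
        using c1 insert.hyps unfolding sp_def by simp
      then show False
        using t1 by (auto simp: T0_def)
    qed
    \<comment> \<open>Modulo \<open>T0\<close>, every element of \<open>T\<close> is a multiple of
      \<open>t1\<close>: the factor \<open>c b0 / c1 b0\<close> is the one that cancels the
      coefficient of \<open>b0\<close>.\<close>
    have reduce: "\<exists>k. (\<lambda>x. t x - k *\<^sub>R t1 x) \<in> T0" if t: "t \<in> T" for t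
    proof -
      obtain c where c: "AE x in M. t x = (\<Sum>b\<in>insert b0 B. c b *\<^sub>R b x)"
        using insert.prems(3)[OF t] by auto
      define k where "k = c b0 / c1 b0"
      have k: "c b0 = k * c1 b0"
        using c10 by (simp add: k_def)
      have "sp (\<lambda>x. t x - k *\<^sub>R t1 x) (\<lambda>b. c b - k * c1 b)"
        using c c1 unfolding sp_def
        by eventually_elim
          (use insert.hyps k in \<open>simp add: scaleR_sum_right sum_subtractf scaleR_diff_left scaleR_add_right\<close>)
      moreover have "(\<lambda>x. t x - k *\<^sub>R t1 x) \<in> T"
        using L2_subspace_lincomb[OF T t t1(1), of 1 "-k"] by simp
      ultimately show ?thesis
        by (auto simp: T0_def)
    qed
    obtain p1 where p1: "p1 \<in> T0" "\<And>t. t \<in> T0 \<Longrightarrow> L2_inner M (\<lambda>x. t1 x - p1 x) t = 0"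
      using IH[of t1] t1 TL by blast
    obtain p0 where p0: "p0 \<in> T0" "\<And>t. t \<in> T0 \<Longrightarrow> L2_inner M (\<lambda>x. f x - p0 x) t = 0"
      using IH[OF insert.prems(4)] by blast
    \<comment> \<open>The part of \<open>t1\<close> orthogonal to \<open>T0\<close>. The projection
      onto \<open>T\<close> is then the one onto \<open>T0\<close> plus the one onto the line
      through \<open>q\<close>.\<close>
    define q where "q x = t1 x - p1 x" for x
    have T0T: "T0 \<subseteq> T"
      by (auto simp: T0_def)
    have qT: "q \<in> T"
      unfolding q_def using L2_subspace_diff[OF T t1(1)] p1(1) T0T by blast
    have L: "q \<in> L2 M" "p0 \<in> L2 M" "f \<in> L2 M" "(\<lambda>x. f x - p0 x) \<in> L2 M"
      using qT p0 T0T TL insert.prems(4) by (auto intro!: L2_diff)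
    have qt: "L2_inner M q t = 0" if "t \<in> T0" for t
      using p1(2)[OF that] by (simp add: q_def[abs_def])
    \<comment> \<open>The case \<open>q = 0\<close> almost everywhere is harmless: then \<open>k = 0\<close> by the convention \<open>x / 0 = 0\<close>.\<close>
    define k where "k = L2_inner M f q / L2_inner M q q"
    have kq: "k * L2_inner M q q = L2_inner M f q"
    proof (cases "L2_inner M q q = 0")
      case True
      then have "L2_inner M q f = 0"
        using L2_inner_AE_0[OF L(1,3)] L2_inner_self_eq_0[OF L(1)] by blast
      then show ?thesis
        using True by (simp add: L2_inner_commute)
    qed (simp add: k_def)
    define p where "p x = p0 x + k *\<^sub>R q x" for x
    have pT: "p \<in> T"
      using L2_subspace_lincomb[OF T _ qT, of p0 1 k] p0 T0T by (auto simp: p_def[abs_def])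
    have r: "L2_inner M (\<lambda>x. f x - p x) t = L2_inner M (\<lambda>x. f x - p0 x) t - k * L2_inner M q t"
      if "t \<in> L2 M" for t
      using L2_inner_lincomb[OF L(4) L(1) that, of 1 "-k"]
      by (simp add: p_def[abs_def] algebra_simps)
    have r0: "L2_inner M (\<lambda>x. f x - p x) t = 0" if "t \<in> T0" for t
      using r[of t] p0(2)[OF that] qt[OF that] that T0T TL by auto
    have rq: "L2_inner M (\<lambda>x. f x - p x) q = 0"
      using r[OF L(1)] L2_inner_diff[OF L(3,2,1)] qt[OF p0(1)] kq
      by (simp add: L2_inner_commute)
    have "L2_inner M (\<lambda>x. f x - p x) t = 0" if t: "t \<in> T" for t
    proof -
      obtain c where c: "(\<lambda>x. t x - c *\<^sub>R t1 x) \<in> T0"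
        using reduce[OF t] by blast
      \<comment> \<open>Splits \<open>t\<close> as \<open>s + c q\<close> with \<open>s\<close> in
        \<open>T0\<close>, so that orthogonality of the residual needs checking only against
        \<open>T0\<close> and \<open>q\<close>.\<close>
      define s where "s x = (t x - c *\<^sub>R t1 x) + c *\<^sub>R p1 x" for x
      have s: "s \<in> T0"
        using L2_subspace_lincomb[OF T0 c p1(1), of 1 c] by (simp add: s_def[abs_def])
      have "t = (\<lambda>x. 1 *\<^sub>R s x + c *\<^sub>R q x)"
        by (auto simp: s_def q_def algebra_simps)
      moreover have "L2_inner M (\<lambda>x. 1 *\<^sub>R s x + c *\<^sub>R q x) (\<lambda>x. f x - p x) = 0"
        using L2_inner_lincomb[of s M q "\<lambda>x. f x - p x" 1 c] s T0T TL L pT r0[OF s] rq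
        by (auto simp: L2_inner_commute L2_diff subset_iff)
      ultimately show ?thesis
        by (simp add: L2_inner_commute)
    qed
    with pT show ?thesis
      by blast
  qed
qed

lemma L2_projection:
  assumes "L2_subspace M S" "L2_finite_dim M S" "L2_subspace M T" "T \<subseteq> S" "f \<in> L2 M"
  obtains p where "p \<in> T" "\<And>t. t \<in> T \<Longrightarrow> L2_inner M (\<lambda>x. f x - p x) t = 0"
proof -
  obtain B where "finite B" "B \<subseteq> S" "\<forall>f\<in>S. \<exists>c. AE x in M. f x = (\<Sum>b\<in>B. c b *\<^sub>R b x)"
    using assms(2) unfolding L2_finite_dim_def by blast
  moreover have "S \<subseteq> L2 M"
    using assms(1) by (simp add: L2_subspace_def)
  ultimately show thesis
    using L2_projection_spanned[of B M T f] assms that by blast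
qed

text \<open>The residual of the projection of \<open>f\<close> onto \<open>T\<close> lies in the
  complement, hence vanishes almost everywhere. So \<open>f\<close> agrees almost everywhere with an
  element of \<open>T\<close>, and closure under such equality puts \<open>f\<close> itself into
  \<open>T\<close>.\<close>

lemma L2_subspace_eqI:
  assumes S: "L2_subspace M S" "L2_finite_dim M S" and T: "L2_subspace M T" "T \<subseteq> S"
    and perp: "\<And>f. f \<in> L2_perp M S T \<Longrightarrow> AE x in M. f x = 0"
  shows "T = S"
proof (rule equalityI[OF T(2)], rule subsetI)
  fix f
  assume f: "f \<in> S"
  then have fL: "f \<in> L2 M"
    using S by (auto simp: L2_subspace_def)
  obtain p where p: "p \<in> T" "\<And>t. t \<in> T \<Longrightarrow> L2_inner M (\<lambda>x. f x - p x) t = 0"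
    using L2_projection[OF S T fL] by blast
  have "(\<lambda>x. f x - p x) \<in> L2_perp M S T"
    using p L2_subspace_diff[OF S(1) f] T by (auto simp: L2_perp_def)
  then have "AE x in M. p x = f x"
    using perp[of "\<lambda>x. f x - p x"] by auto
  then show "f \<in> T"
    using L2_subspace_cong_AE[OF T(1) p(1) L2_measurable[OF fL]] by blast
qed

text \<open>The Riesz representation, with the representing element located in \<open>T\<close>: as
  \<open>F\<close> kills the complement of \<open>T\<close>, its value at \<open>f\<close> is that
  at the projection of \<open>f\<close> onto \<open>T\<close>. On \<open>T\<close> the representing
  element is a multiple of a vector orthogonal to the kernel of \<open>F\<close>. The functional
  acts on representatives, and \<open>AE0\<close> makes it descend to classes.\<close>

lemma L2_riesz_perp:
  assumes S: "L2_subspace M S" "L2_finite_dim M S" and T: "L2_subspace M T" "T \<subseteq> S"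
    and lin: "\<And>f g a b. f \<in> S \<Longrightarrow> g \<in> S \<Longrightarrow> F (\<lambda>x. a *\<^sub>R f x + b *\<^sub>R g x) = a * F f + b * F g"
    and AE0: "\<And>f. f \<in> S \<Longrightarrow> AE x in M. f x = 0 \<Longrightarrow> F f = (0::real)"
    and perp: "\<And>f. f \<in> L2_perp M S T \<Longrightarrow> F f = 0"
  obtains e where "e \<in> T" "\<And>f. f \<in> S \<Longrightarrow> F f = L2_inner M f e"
proof -
  have SL: "S \<subseteq> L2 M"
    using S by (simp add: L2_subspace_def)
  have AE: "F f = F g" if "f \<in> S" "g \<in> S" "AE x in M. f x = g x" for f g
  proof -
    have "F (\<lambda>x. 1 *\<^sub>R f x + (-1) *\<^sub>R g x) = 0"
      using that by (intro AE0 L2_subspace_lincomb[OF S(1)]) auto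
    then show ?thesis
      using lin[OF that(1,2), of 1 "-1"] by simp
  qed
  have split: "\<exists>p\<in>T. F f = F p \<and> (\<forall>t\<in>T. L2_inner M f t = L2_inner M p t)" if f: "f \<in> S" for f
  proof -
    obtain p where p: "p \<in> T" "\<And>t. t \<in> T \<Longrightarrow> L2_inner M (\<lambda>x. f x - p x) t = 0"
      using L2_projection[OF S T, of f] f SL by blast
    have "F (\<lambda>x. 1 *\<^sub>R f x + (-1) *\<^sub>R p x) = 0"
      using p L2_subspace_diff[OF S(1) f] T by (intro perp) (auto simp: L2_perp_def)
    moreover have "L2_inner M f t = L2_inner M p t" if "t \<in> T" for t
      using p(2)[OF that] L2_inner_diff[of f M p t] f p(1) that T SL by auto
    ultimately show ?thesis
      using p(1) T lin[of f p 1 "-1"] f by auto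
  qed
  \<comment> \<open>The kernel of \<open>F\<close> on \<open>T\<close>.\<close>
  define T0 where "T0 = {t\<in>T. F t = 0}"
  have T0: "L2_subspace M T0"
  proof (rule L2_subspaceI)
    show "T0 \<subseteq> L2 M"
      using T SL by (auto simp: T0_def)
    show "(\<lambda>x. 0) \<in> T0"
      using L2_subspace_zero[OF T(1)] AE0[of "\<lambda>x. 0"] T by (auto simp: T0_def)
    show "(\<lambda>x. a *\<^sub>R f x + b *\<^sub>R g x) \<in> T0" if "f \<in> T0" "g \<in> T0" for f g a b
      using that lin[of f g a b] L2_subspace_lincomb[OF T(1), of f g a b] T by (auto simp: T0_def)
    show "g \<in> T0" if "f \<in> T0" "g \<in> borel_measurable M" "AE x in M. f x = g x" for f g
      using that L2_subspace_cong_AE[OF T(1), of f g] AE[of f g] T by (auto simp: T0_def)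
  qed
  show thesis
  proof (cases "\<exists>t1\<in>T. F t1 \<noteq> 0")
    case False
    then have "F f = L2_inner M f (\<lambda>x. 0)" if "f \<in> S" for f
      using split[OF that] by (auto simp: L2_inner_def)
    then show thesis
      using that[OF L2_subspace_zero[OF T(1)]] by blast
  next
    case True
    then obtain t1 where t1: "t1 \<in> T" "F t1 \<noteq> 0"
      by blast
    have T0S: "T0 \<subseteq> S"
      using T by (auto simp: T0_def)
    obtain p where p: "p \<in> T0" "\<And>t. t \<in> T0 \<Longrightarrow> L2_inner M (\<lambda>x. t1 x - p x) t = 0"
      using L2_projection[OF S T0 T0S, of t1] t1 T SL by blast
    \<comment> \<open>The part of \<open>t1\<close> orthogonal to the kernel. Since \<open>p\<close>
      is in the kernel, \<open>F q = F t1\<close> is nonzero.\<close>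
    define q where "q x = t1 x - p x" for x
    have qT: "q \<in> T"
      using L2_subspace_diff[OF T(1) t1(1), of p] p by (auto simp: q_def[abs_def] T0_def)
    have Fq: "F q \<noteq> 0"
    proof -
      have "t1 \<in> S" "p \<in> S" "F p = 0"
        using t1 p(1) T(2) by (auto simp: T0_def)
      then show ?thesis
        using lin[of t1 p 1 "-1"] t1(2) by (simp add: q_def[abs_def])
    qed
    have qL: "q \<in> L2 M"
      using qT T SL by auto
    have qq: "L2_inner M q q \<noteq> 0"
      using AE0[of q] Fq L2_inner_self_eq_0[OF qL] qT T by auto
    \<comment> \<open>Scaled so that the inner product of \<open>q\<close> with \<open>e\<close> is
      \<open>F q\<close>.\<close>
    define k where "k = F q / L2_inner M q q"
    define e where "e x = k *\<^sub>R q x" for x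
    have eT: "e \<in> T"
      using L2_subspace_lincomb[OF T(1) qT qT, of k 0] by (simp add: e_def[abs_def])
    have inT: "F t = L2_inner M t e" if t: "t \<in> T" for t
    proof -
      \<comment> \<open>Subtracting this multiple of \<open>q\<close> moves \<open>t\<close> into
        the kernel, which is orthogonal to \<open>q\<close>. That determines the inner product of
        \<open>t\<close> with \<open>q\<close>.\<close>
      define s where "s x = 1 *\<^sub>R t x + (- F t / F q) *\<^sub>R q x" for x
      have "s \<in> T"
        unfolding s_def by (rule L2_subspace_lincomb[OF T(1) t qT])
      moreover have "F s = 0"
        unfolding s_def using lin[of t q 1 "- F t / F q"] t qT T Fq by auto
      ultimately have "L2_inner M q s = 0"
        using p(2)[of s] by (simp add: T0_def q_def[abs_def])
      moreover have "L2_inner M s q = 1 * L2_inner M t q + (- F t / F q) * L2_inner M q q"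
        unfolding s_def by (rule L2_inner_lincomb) (use t qT T SL in auto)
      ultimately have "L2_inner M t q = F t / F q * L2_inner M q q"
        by (simp add: L2_inner_commute)
      moreover have "L2_inner M t e = k * L2_inner M t q"
        by (simp add: e_def L2_inner_def)
      ultimately show ?thesis
        using Fq qq by (simp add: k_def)
    qed
    have "F f = L2_inner M f e" if "f \<in> S" for f
      using split[OF that] inT eT by auto
    then show thesis
      using that[OF eT] by blast
  qed
qed

section \<open>Smooth functions on the element\<close>

lemma polyhedral_element_compact: "polyhedral_element K \<Longrightarrow> compact K"
  by (auto simp: polyhedral_element_def polytope_imp_compact)

lemma frechet_derivative_lincomb:
  assumes "f differentiable (at x)" "g differentiable (at x)"
  shows "frechet_derivative (\<lambda>x. a *\<^sub>R f x + b *\<^sub>R g x) (at x)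
    = (\<lambda>h. a *\<^sub>R frechet_derivative f (at x) h + b *\<^sub>R frechet_derivative g (at x) h)"
proof -
  have "((\<lambda>x. a *\<^sub>R f x + b *\<^sub>R g x) has_derivative
      (\<lambda>h. a *\<^sub>R frechet_derivative f (at x) h + b *\<^sub>R frechet_derivative g (at x) h)) (at x)"
    using assms by (intro derivative_intros) (simp_all add: frechet_derivative_works[symmetric])
  then show ?thesis
    by (rule frechet_derivative_at[symmetric])
qed

lemma C_diff_lincomb: "C_diff k f \<Longrightarrow> C_diff k g \<Longrightarrow> C_diff k (\<lambda>x. a *\<^sub>R f x + b *\<^sub>R g x)"
proof (induction k arbitrary: f g)
  case 0
  then show ?case
    by (auto intro!: continuous_intros)
next
  case (Suc k)
  have "C_diff k (\<lambda>x. frechet_derivative (\<lambda>x. a *\<^sub>R f x + b *\<^sub>R g x) (at x) i)" if "i \<in> Basis" for i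
    using Suc.prems that by (simp add: frechet_derivative_lincomb Suc.IH)
  then show ?case
    using Suc.prems by (auto intro!: derivative_intros)
qed

lemma C_infinity_lincomb:
  "C_infinity f \<Longrightarrow> C_infinity g \<Longrightarrow> C_infinity (\<lambda>x. a *\<^sub>R f x + b *\<^sub>R g x)"
  by (simp add: C_infinity_def C_diff_lincomb)

lemma C_infinity_continuous: "C_infinity f \<Longrightarrow> continuous_on UNIV f"
  unfolding C_infinity_def by (metis C_diff.simps(1))

lemma C_infinity_differentiable: "C_infinity f \<Longrightarrow> f differentiable (at x)"
  unfolding C_infinity_def by (metis C_diff.simps(2))

lemma C_infinity_continuous_frechet_derivative:
  assumes "C_infinity f" "b \<in> Basis"
  shows "continuous_on UNIV (\<lambda>x. frechet_derivative f (at x) b)"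
proof -
  have "C_diff (Suc 0) f"
    using assms unfolding C_infinity_def by blast
  then show ?thesis
    using assms(2) by simp
qed

lemma jacobian_lincomb:
  fixes f g :: "real ^ 'n \<Rightarrow> real ^ 'm"
  assumes "C_infinity f" "C_infinity g"
  shows "jacobian (\<lambda>x. a *\<^sub>R f x + b *\<^sub>R g x) (at x) = a *\<^sub>R jacobian f (at x) + b *\<^sub>R jacobian g (at x)"
  using assms by (simp add: jacobian_def frechet_derivative_lincomb C_infinity_differentiable matrix_def vec_eq_iff)

lemma continuous_on_jacobian:
  fixes f :: "real ^ 'n \<Rightarrow> real ^ 'm"
  assumes "C_infinity f"
  shows "continuous_on UNIV (\<lambda>x. jacobian f (at x))"
  unfolding jacobian_def matrix_def
  by (intro continuous_intros C_infinity_continuous_frechet_derivative assms) simp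

text \<open>A continuous function is bounded on the compact set \<open>K\<close>, which has finite
  measure.\<close>

lemma continuous_in_L2:
  fixes f :: "real ^ 'n \<Rightarrow> 'b::euclidean_space"
  assumes K: "compact K" and f: "continuous_on UNIV f"
  shows "f \<in> L2 (lebesgue_on K)"
proof -
  have c: "continuous_on K f"
    using f continuous_on_subset by blast
  have Ks: "K \<in> sets lebesgue"
    using K by (simp add: compact_imp_closed)
  have m: "f \<in> borel_measurable (lebesgue_on K)"
    by (rule continuous_imp_measurable_on_sets_lebesgue[OF c Ks])
  have "bounded (f ` K)"
    by (intro compact_imp_bounded compact_continuous_image c K)
  then obtain B where B: "\<And>x. x \<in> K \<Longrightarrow> norm (f x) \<le> B"
    unfolding bounded_iff by auto
  interpret finite_measure "lebesgue_on K"
    using K lmeasurable_compact[OF K]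
    by (intro finite_measure_lebesgue_on)
  have "integrable (lebesgue_on K) (\<lambda>x. (norm (f x))\<^sup>2)"
  proof (rule integrable_const_bound[where B="B\<^sup>2"])
    show "AE x in lebesgue_on K. norm ((norm (f x))\<^sup>2) \<le> B\<^sup>2"
      using B by (intro AE_I2) (auto intro!: power_mono)
    show "(\<lambda>x. (norm (f x))\<^sup>2) \<in> borel_measurable (lebesgue_on K)"
      using m by measurable
  qed
  with m show ?thesis
    by (simp add: L2_def)
qed

text \<open>Measurability concerns just the sigma-algebra of \<open>boundary_measure K\<close>, and
  that is the Borel one restricted to the frontier.\<close>

lemma continuous_measurable_boundary_measure:
  fixes f :: "real ^ 'n \<Rightarrow> 'b::topological_space"
  assumes f: "continuous_on UNIV f"
  shows "f \<in> borel_measurable (boundary_measure K)"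
proof -
  have s: "sets (measure_of UNIV (sets borel) (hausdorff_outer (CARD('n) - 1))) = sets (borel :: (real ^ 'n) measure)"
    using sets.sets_measure_of_eq[of borel] by simp
  have "f \<in> borel_measurable (measure_of UNIV (sets borel) (hausdorff_outer (CARD('n) - 1)))"
    using borel_measurable_continuous_onI[OF f] measurable_cong_sets[OF s refl] by blast
  then show ?thesis
    unfolding boundary_measure_def by (rule measurable_restrict_space1)
qed

lemma continuous_on_partial:
  fixes \<phi> :: "real ^ 'n \<Rightarrow> real"
  assumes "C_infinity \<phi>"
  shows "continuous_on UNIV (partial j \<phi>)"
  using C_infinity_continuous_frechet_derivative[OF assms, of "axis j 1"]
  by (simp add: partial_def[abs_def])

section \<open>Weak derivatives and traces\<close>

text \<open>The defining integrals as inner products of the rows of \<open>\<tau>\<close> with the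
  gradient of \<open>\<phi>\<close>, so that bilinearity of \<open>L2_inner\<close> and its
  invariance under almost-everywhere equality apply.\<close>

lemma has_weak_div_altdef:
  "has_weak_div K \<tau> d \<longleftrightarrow>
     \<tau> \<in> L2 (lebesgue_on K) \<and> d \<in> L2 (lebesgue_on K) \<and>
     (\<forall>i \<phi>. test_function K \<phi> \<longrightarrow>
        L2_inner (lebesgue_on K) (\<lambda>x. \<tau> x $ i) (\<lambda>x. \<chi> j. partial j \<phi> x)
          = - L2_inner (lebesgue_on K) (\<lambda>x. d x $ i) \<phi>)"
  by (simp add: has_weak_div_def L2_inner_def inner_vec_def)

lemma has_weak_gradient_altdef:
  "has_weak_gradient K v G \<longleftrightarrow>
     v \<in> L2 (lebesgue_on K) \<and> G \<in> L2 (lebesgue_on K) \<and>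
     (\<forall>i j \<phi>. test_function K \<phi> \<longrightarrow>
        L2_inner (lebesgue_on K) (\<lambda>x. v x $ i) (partial j \<phi>)
          = - L2_inner (lebesgue_on K) (\<lambda>x. G x $ i $ j) \<phi>)"
  by (simp add: has_weak_gradient_def L2_inner_def)

lemma test_function_L2:
  assumes "compact K" "test_function K \<phi>"
  shows "\<phi> \<in> L2 (lebesgue_on K)" "partial j \<phi> \<in> L2 (lebesgue_on K)"
    "(\<lambda>x. \<chi> j. partial j \<phi> x) \<in> L2 (lebesgue_on K)"
proof -
  have "C_infinity \<phi>"
    using assms by (simp add: test_function_def)
  then show "\<phi> \<in> L2 (lebesgue_on K)" "partial j \<phi> \<in> L2 (lebesgue_on K)"
    "(\<lambda>x. \<chi> j. partial j \<phi> x) \<in> L2 (lebesgue_on K)"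
    using assms(1)
    by (auto intro!: continuous_in_L2 C_infinity_continuous continuous_on_vec_lambda continuous_on_partial)
qed

lemma has_weak_div_lincomb:
  assumes K: "compact K" and "has_weak_div K \<tau> d" "has_weak_div K \<tau>' d'"
  shows "has_weak_div K (\<lambda>x. a *\<^sub>R \<tau> x + b *\<^sub>R \<tau>' x) (\<lambda>x. a *\<^sub>R d x + b *\<^sub>R d' x)"
  unfolding has_weak_div_altdef
proof (intro conjI allI impI)
  have L: "\<tau> \<in> L2 (lebesgue_on K)" "\<tau>' \<in> L2 (lebesgue_on K)"
    "d \<in> L2 (lebesgue_on K)" "d' \<in> L2 (lebesgue_on K)"
    using assms by (auto simp: has_weak_div_def)
  then show "(\<lambda>x. a *\<^sub>R \<tau> x + b *\<^sub>R \<tau>' x) \<in> L2 (lebesgue_on K)"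
    "(\<lambda>x. a *\<^sub>R d x + b *\<^sub>R d' x) \<in> L2 (lebesgue_on K)"
    by (auto intro: L2_lincomb)
  fix i \<phi>
  assume t: "test_function K \<phi>"
  note tL = test_function_L2[OF K t]
  show "L2_inner (lebesgue_on K) (\<lambda>x. (a *\<^sub>R \<tau> x + b *\<^sub>R \<tau>' x) $ i) (\<lambda>x. \<chi> j. partial j \<phi> x)
          = - L2_inner (lebesgue_on K) (\<lambda>x. (a *\<^sub>R d x + b *\<^sub>R d' x) $ i) \<phi>"
    using assms t L2_inner_lincomb[OF L(1,2)[THEN L2_nth] tL(3), of a i b i]
      L2_inner_lincomb[OF L(3,4)[THEN L2_nth] tL(1), of a i b i]
    by (simp add: has_weak_div_altdef)
qed

lemma has_weak_gradient_lincomb: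
  assumes K: "compact K" and "has_weak_gradient K v G" "has_weak_gradient K v' G'"
  shows "has_weak_gradient K (\<lambda>x. a *\<^sub>R v x + b *\<^sub>R v' x) (\<lambda>x. a *\<^sub>R G x + b *\<^sub>R G' x)"
  unfolding has_weak_gradient_altdef
proof (intro conjI allI impI)
  have L: "v \<in> L2 (lebesgue_on K)" "v' \<in> L2 (lebesgue_on K)"
    "G \<in> L2 (lebesgue_on K)" "G' \<in> L2 (lebesgue_on K)"
    using assms by (auto simp: has_weak_gradient_def)
  then show "(\<lambda>x. a *\<^sub>R v x + b *\<^sub>R v' x) \<in> L2 (lebesgue_on K)"
    "(\<lambda>x. a *\<^sub>R G x + b *\<^sub>R G' x) \<in> L2 (lebesgue_on K)"
    by (auto intro: L2_lincomb)
  fix i j \<phi>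
  assume t: "test_function K \<phi>"
  note tL = test_function_L2[OF K t]
  show "L2_inner (lebesgue_on K) (\<lambda>x. (a *\<^sub>R v x + b *\<^sub>R v' x) $ i) (partial j \<phi>)
          = - L2_inner (lebesgue_on K) (\<lambda>x. (a *\<^sub>R G x + b *\<^sub>R G' x) $ i $ j) \<phi>"
    using assms t L2_inner_lincomb[OF L(1,2)[THEN L2_nth] tL(2), of a i b i]
      L2_inner_lincomb[OF L(3,4)[THEN L2_nth, THEN L2_nth] tL(1), of a i j b i j]
    by (simp add: has_weak_gradient_altdef)
qed

text \<open>Transposition is continuous and preserves the Frobenius norm.\<close>

lemma L2_transpose:
  fixes G :: "'a \<Rightarrow> real ^ 'n ^ 'n"
  assumes "G \<in> L2 M"
  shows "(\<lambda>x. transpose (G x)) \<in> L2 M"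
proof -
  have "(\<lambda>x. transpose (G x)) \<in> borel_measurable M"
    unfolding transpose_def
    by (rule borel_measurable_continuous_on[OF _ L2_measurable[OF assms], of "\<lambda>A. \<chi> i j. A $ j $ i"])
      (intro continuous_intros)
  moreover have "(norm (transpose A))\<^sup>2 = (norm A)\<^sup>2" for A :: "real ^ 'n ^ 'n"
    unfolding power2_norm_eq_inner inner_vec_def transpose_def
    by (simp add: sum.swap[of "\<lambda>i j. A $ i $ j * A $ i $ j"])
  ultimately show ?thesis
    using assms by (simp add: L2_def)
qed

lemma has_weak_strainI:
  assumes "has_weak_gradient K v G"
  shows "has_weak_strain K v (\<lambda>x. (1 / 2) *\<^sub>R (G x + transpose (G x)))"
proof -
  have "G \<in> L2 (lebesgue_on K)"
    using assms by (simp add: has_weak_gradient_def)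
  then have "(\<lambda>x. (1 / 2) *\<^sub>R G x + (1 / 2) *\<^sub>R transpose (G x)) \<in> L2 (lebesgue_on K)"
    by (intro L2_lincomb L2_transpose)
  then show ?thesis
    using assms by (auto simp: has_weak_strain_def scaleR_add_right)
qed

lemma has_weak_strain_lincomb:
  assumes K: "compact K" and "has_weak_strain K v E" "has_weak_strain K v' E'"
  shows "has_weak_strain K (\<lambda>x. a *\<^sub>R v x + b *\<^sub>R v' x) (\<lambda>x. a *\<^sub>R E x + b *\<^sub>R E' x)"
proof -
  obtain G G' where G: "has_weak_gradient K v G" "has_weak_gradient K v' G'"
    and E: "AE x in lebesgue_on K. E x = (1 / 2) *\<^sub>R (G x + transpose (G x))"
    and E': "AE x in lebesgue_on K. E' x = (1 / 2) *\<^sub>R (G' x + transpose (G' x))"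
    using assms by (auto simp: has_weak_strain_def)
  have "AE x in lebesgue_on K. a *\<^sub>R E x + b *\<^sub>R E' x
      = (1 / 2) *\<^sub>R ((a *\<^sub>R G x + b *\<^sub>R G' x) + transpose (a *\<^sub>R G x + b *\<^sub>R G' x))"
    using E E' by eventually_elim (simp add: vec_eq_iff transpose_def algebra_simps)
  then show ?thesis
    using assms has_weak_gradient_lincomb[OF K G, of a b] unfolding has_weak_strain_def
    by (auto intro: L2_lincomb)
qed

lemma has_weak_strain_cong_AE:
  assumes "has_weak_strain K v E" "E' \<in> borel_measurable (lebesgue_on K)"
    and "AE x in lebesgue_on K. E x = E' x"
  shows "has_weak_strain K v E'"
proof -
  obtain G where G: "has_weak_gradient K v G"
    and E: "AE x in lebesgue_on K. E x = (1 / 2) *\<^sub>R (G x + transpose (G x))"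
    using assms by (auto simp: has_weak_strain_def)
  have "AE x in lebesgue_on K. E' x = (1 / 2) *\<^sub>R (G x + transpose (G x))"
    using E assms(3) by eventually_elim simp
  moreover have "E' \<in> L2 (lebesgue_on K)"
    using assms L2_cong_AE[of E] by (auto simp: has_weak_strain_def)
  ultimately show ?thesis
    using G by (auto simp: has_weak_strain_def)
qed

lemma has_weak_div_cong_AE:
  assumes K: "compact K" and \<tau>: "has_weak_div K \<tau> d"
    and m: "\<tau>' \<in> borel_measurable (lebesgue_on K)" "d' \<in> borel_measurable (lebesgue_on K)"
    and ae: "AE x in lebesgue_on K. \<tau> x = \<tau>' x" "AE x in lebesgue_on K. d x = d' x"
  shows "has_weak_div K \<tau>' d'"
  unfolding has_weak_div_altdef
proof (intro conjI allI impI)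
  have L: "\<tau> \<in> L2 (lebesgue_on K)" "d \<in> L2 (lebesgue_on K)"
    using \<tau> by (auto simp: has_weak_div_def)
  show L': "\<tau>' \<in> L2 (lebesgue_on K)" "d' \<in> L2 (lebesgue_on K)"
    using L2_cong_AE[OF L(1) m(1) ae(1)] L2_cong_AE[OF L(2) m(2) ae(2)] .
  fix i \<phi>
  assume t: "test_function K \<phi>"
  note tL = test_function_L2[OF K t]
  have "L2_inner (lebesgue_on K) (\<lambda>x. \<tau> x $ i) (\<lambda>x. \<chi> j. partial j \<phi> x)
      = L2_inner (lebesgue_on K) (\<lambda>x. \<tau>' x $ i) (\<lambda>x. \<chi> j. partial j \<phi> x)"
    by (rule L2_inner_cong_AE) (use L L' tL ae in \<open>auto intro: L2_nth\<close>)
  moreover have "L2_inner (lebesgue_on K) (\<lambda>x. d x $ i) \<phi> = L2_inner (lebesgue_on K) (\<lambda>x. d' x $ i) \<phi>"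
    by (rule L2_inner_cong_AE) (use L L' tL ae in \<open>auto intro: L2_nth\<close>)
  ultimately show "L2_inner (lebesgue_on K) (\<lambda>x. \<tau>' x $ i) (\<lambda>x. \<chi> j. partial j \<phi> x)
          = - L2_inner (lebesgue_on K) (\<lambda>x. d' x $ i) \<phi>"
    using \<tau> t by (simp add: has_weak_div_altdef)
qed

lemma has_weak_gradient_cong_AE:
  assumes K: "compact K" and v: "has_weak_gradient K v G"
    and m: "v' \<in> borel_measurable (lebesgue_on K)"
    and ae: "AE x in lebesgue_on K. v x = v' x"
  shows "has_weak_gradient K v' G"
  unfolding has_weak_gradient_altdef
proof (intro conjI allI impI)
  have L: "v \<in> L2 (lebesgue_on K)"
    using v by (auto simp: has_weak_gradient_def)
  show L': "v' \<in> L2 (lebesgue_on K)"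
    using L2_cong_AE[OF L m ae] .
  show "G \<in> L2 (lebesgue_on K)"
    using v by (auto simp: has_weak_gradient_def)
  fix i j \<phi>
  assume t: "test_function K \<phi>"
  have "L2_inner (lebesgue_on K) (\<lambda>x. v x $ i) (partial j \<phi>)
      = L2_inner (lebesgue_on K) (\<lambda>x. v' x $ i) (partial j \<phi>)"
    by (rule L2_inner_cong_AE) (use L L' test_function_L2[OF K t] ae in \<open>auto intro: L2_nth\<close>)
  then show "L2_inner (lebesgue_on K) (\<lambda>x. v' x $ i) (partial j \<phi>)
          = - L2_inner (lebesgue_on K) (\<lambda>x. G x $ i $ j) \<phi>"
    using v t by (simp add: has_weak_gradient_altdef)
qed

text \<open>The same approximating sequence works for both functions, because they enter its limits
  only through integrals.\<close>

lemma has_trace_cong_AE: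
  assumes K: "compact K" and v: "has_trace K v h"
    and m: "v' \<in> borel_measurable (lebesgue_on K)"
    and ae: "AE x in lebesgue_on K. v x = v' x"
  shows "has_trace K v' h"
proof -
  have "(\<integral>\<^sup>+x. ennreal ((norm (\<phi> k x - v x))\<^sup>2) \<partial>lebesgue_on K)
      = (\<integral>\<^sup>+x. ennreal ((norm (\<phi> k x - v' x))\<^sup>2) \<partial>lebesgue_on K)" for \<phi> :: "nat \<Rightarrow> _" and k
    by (rule nn_integral_cong_AE) (use ae in \<open>auto elim: eventually_mono\<close>)
  then have "L2_tendsto (lebesgue_on K) \<phi> v \<Longrightarrow> L2_tendsto (lebesgue_on K) \<phi> v'" for \<phi>
    by (simp add: L2_tendsto_def)
  then show ?thesis
    using v has_weak_gradient_cong_AE[OF K _ m ae] unfolding has_trace_def by blast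
qed

text \<open>The combination of the two approximating sequences approximates the combination in all
  three senses: values, Jacobians and boundary values.\<close>

lemma has_trace_lincomb:
  assumes K: "compact K" and "has_trace K v h" "has_trace K v' h'"
  shows "has_trace K (\<lambda>x. a *\<^sub>R v x + b *\<^sub>R v' x) (\<lambda>x. a *\<^sub>R h x + b *\<^sub>R h' x)"
proof -
  obtain G \<phi> where G: "has_weak_gradient K v G" and \<phi>: "\<And>k. C_infinity (\<phi> k)"
    and lim: "L2_tendsto (lebesgue_on K) \<phi> v"
      "L2_tendsto (lebesgue_on K) (\<lambda>k x. jacobian (\<phi> k) (at x)) G"
      "L2_tendsto (boundary_measure K) \<phi> h"
    using assms(2) unfolding has_trace_def by blast
  obtain G' \<phi>' where G': "has_weak_gradient K v' G'" and \<phi>': "\<And>k. C_infinity (\<phi>' k)"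
    and lim': "L2_tendsto (lebesgue_on K) \<phi>' v'"
      "L2_tendsto (lebesgue_on K) (\<lambda>k x. jacobian (\<phi>' k) (at x)) G'"
      "L2_tendsto (boundary_measure K) \<phi>' h'"
    using assms(3) unfolding has_trace_def by blast
  have m: "v \<in> borel_measurable (lebesgue_on K)" "v' \<in> borel_measurable (lebesgue_on K)"
    "G \<in> borel_measurable (lebesgue_on K)" "G' \<in> borel_measurable (lebesgue_on K)"
    "h \<in> borel_measurable (boundary_measure K)" "h' \<in> borel_measurable (boundary_measure K)"
    using G G' assms(2,3) by (auto simp: has_weak_gradient_def has_trace_def intro: L2_measurable)
  have mK: "f \<in> borel_measurable (lebesgue_on K)"
    if "continuous_on UNIV f" for f :: "real ^ 'a \<Rightarrow> 'b::euclidean_space"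
    using continuous_in_L2[OF K that] by (rule L2_measurable)
  have "L2_tendsto (lebesgue_on K) (\<lambda>k x. a *\<^sub>R \<phi> k x + b *\<^sub>R \<phi>' k x) (\<lambda>x. a *\<^sub>R v x + b *\<^sub>R v' x)"
    by (intro L2_tendsto_lincomb m lim lim' mK C_infinity_continuous \<phi> \<phi>')
  moreover have "L2_tendsto (lebesgue_on K)
      (\<lambda>k x. a *\<^sub>R jacobian (\<phi> k) (at x) + b *\<^sub>R jacobian (\<phi>' k) (at x)) (\<lambda>x. a *\<^sub>R G x + b *\<^sub>R G' x)"
    by (intro L2_tendsto_lincomb m lim lim' mK continuous_on_jacobian \<phi> \<phi>')
  then have "L2_tendsto (lebesgue_on K)
      (\<lambda>k x. jacobian (\<lambda>x. a *\<^sub>R \<phi> k x + b *\<^sub>R \<phi>' k x) (at x)) (\<lambda>x. a *\<^sub>R G x + b *\<^sub>R G' x)"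
    by (simp add: jacobian_lincomb \<phi> \<phi>')
  moreover have "L2_tendsto (boundary_measure K) (\<lambda>k x. a *\<^sub>R \<phi> k x + b *\<^sub>R \<phi>' k x) (\<lambda>x. a *\<^sub>R h x + b *\<^sub>R h' x)"
    by (intro L2_tendsto_lincomb m lim lim' continuous_measurable_boundary_measure C_infinity_continuous \<phi> \<phi>')
  moreover have "(\<lambda>x. a *\<^sub>R h x + b *\<^sub>R h' x) \<in> L2 (boundary_measure K)"
    using assms(2,3) by (auto simp: has_trace_def intro: L2_lincomb)
  moreover have "\<forall>k. C_infinity (\<lambda>x. a *\<^sub>R \<phi> k x + b *\<^sub>R \<phi>' k x)"
    by (simp add: C_infinity_lincomb \<phi> \<phi>')
  moreover have "has_weak_gradient K (\<lambda>x. a *\<^sub>R v x + b *\<^sub>R v' x) (\<lambda>x. a *\<^sub>R G x + b *\<^sub>R G' x)"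
    by (rule has_weak_gradient_lincomb[OF K G G'])
  ultimately show ?thesis
    unfolding has_trace_def
    by (intro conjI exI[of _ "\<lambda>x. a *\<^sub>R G x + b *\<^sub>R G' x"]
        exI[of _ "\<lambda>k x. a *\<^sub>R \<phi> k x + b *\<^sub>R \<phi>' k x"])
qed

lemma has_normal_trace_altdef:
  "has_normal_trace K \<tau> g \<longleftrightarrow>
     g \<in> L2 (boundary_measure K) \<and>
     (\<exists>d. has_weak_div K \<tau> d \<and>
        (\<forall>\<phi>. C_infinity \<phi> \<longrightarrow>
           has_bochner_integral (boundary_measure K) (\<lambda>x. g x \<bullet> \<phi> x)
             (L2_inner (lebesgue_on K) d \<phi> + L2_inner (lebesgue_on K) \<tau> (\<lambda>x. jacobian \<phi> (at x)))))"
  by (simp add: has_normal_trace_def L2_inner_def)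

lemma has_normal_trace_lincomb:
  assumes K: "compact K" and "has_normal_trace K \<tau> g" "has_normal_trace K \<tau>' g'"
  shows "has_normal_trace K (\<lambda>x. a *\<^sub>R \<tau> x + b *\<^sub>R \<tau>' x) (\<lambda>x. a *\<^sub>R g x + b *\<^sub>R g' x)"
proof -
  obtain d where d: "has_weak_div K \<tau> d" and g: "\<And>\<phi>. C_infinity \<phi> \<Longrightarrow>
           has_bochner_integral (boundary_measure K) (\<lambda>x. g x \<bullet> \<phi> x)
             (L2_inner (lebesgue_on K) d \<phi> + L2_inner (lebesgue_on K) \<tau> (\<lambda>x. jacobian \<phi> (at x)))"
    using assms(2) by (auto simp: has_normal_trace_altdef)
  obtain d' where d': "has_weak_div K \<tau>' d'" and g': "\<And>\<phi>. C_infinity \<phi> \<Longrightarrow>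
           has_bochner_integral (boundary_measure K) (\<lambda>x. g' x \<bullet> \<phi> x)
             (L2_inner (lebesgue_on K) d' \<phi> + L2_inner (lebesgue_on K) \<tau>' (\<lambda>x. jacobian \<phi> (at x)))"
    using assms(3) by (auto simp: has_normal_trace_altdef)
  have L: "\<tau> \<in> L2 (lebesgue_on K)" "\<tau>' \<in> L2 (lebesgue_on K)"
    "d \<in> L2 (lebesgue_on K)" "d' \<in> L2 (lebesgue_on K)"
    using d d' by (auto simp: has_weak_div_def)
  have "has_bochner_integral (boundary_measure K) (\<lambda>x. (a *\<^sub>R g x + b *\<^sub>R g' x) \<bullet> \<phi> x)
      (L2_inner (lebesgue_on K) (\<lambda>x. a *\<^sub>R d x + b *\<^sub>R d' x) \<phi>
        + L2_inner (lebesgue_on K) (\<lambda>x. a *\<^sub>R \<tau> x + b *\<^sub>R \<tau>' x) (\<lambda>x. jacobian \<phi> (at x)))"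
    if \<phi>: "C_infinity \<phi>" for \<phi>
  proof -
    have "\<phi> \<in> L2 (lebesgue_on K)" "(\<lambda>x. jacobian \<phi> (at x)) \<in> L2 (lebesgue_on K)"
      by (intro continuous_in_L2 K C_infinity_continuous continuous_on_jacobian \<phi>)+
    moreover have "has_bochner_integral (boundary_measure K) (\<lambda>x. a *\<^sub>R (g x \<bullet> \<phi> x) + b *\<^sub>R (g' x \<bullet> \<phi> x))
       (a *\<^sub>R (L2_inner (lebesgue_on K) d \<phi> + L2_inner (lebesgue_on K) \<tau> (\<lambda>x. jacobian \<phi> (at x)))
        + b *\<^sub>R (L2_inner (lebesgue_on K) d' \<phi> + L2_inner (lebesgue_on K) \<tau>' (\<lambda>x. jacobian \<phi> (at x))))"
      by (intro has_bochner_integral_add has_bochner_integral_scaleR_right g g' \<phi>)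
    ultimately show ?thesis
      by (simp add: L2_inner_lincomb L inner_add_left algebra_simps)
  qed
  moreover have "(\<lambda>x. a *\<^sub>R g x + b *\<^sub>R g' x) \<in> L2 (boundary_measure K)"
    using assms by (auto simp: has_normal_trace_def intro: L2_lincomb)
  ultimately show ?thesis
    unfolding has_normal_trace_altdef using has_weak_div_lincomb[OF K d d', of a b] by blast
qed

lemma has_normal_trace_cong_AE:
  assumes K: "compact K" and \<tau>: "has_normal_trace K \<tau> g"
    and m: "\<tau>' \<in> borel_measurable (lebesgue_on K)" "g' \<in> borel_measurable (boundary_measure K)"
    and ae: "AE x in lebesgue_on K. \<tau> x = \<tau>' x" "AE x in boundary_measure K. g x = g' x"
  shows "has_normal_trace K \<tau>' g'"
proof -
  obtain d where d: "has_weak_div K \<tau> d" and g: "\<And>\<phi>. C_infinity \<phi> \<Longrightarrow>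
           has_bochner_integral (boundary_measure K) (\<lambda>x. g x \<bullet> \<phi> x)
             (L2_inner (lebesgue_on K) d \<phi> + L2_inner (lebesgue_on K) \<tau> (\<lambda>x. jacobian \<phi> (at x)))"
    using \<tau> by (auto simp: has_normal_trace_altdef)
  have gL: "g \<in> L2 (boundary_measure K)"
    using \<tau> by (simp add: has_normal_trace_def)
  have d': "has_weak_div K \<tau>' d"
    using d by (intro has_weak_div_cong_AE[OF K d m(1)] ae) (auto simp: has_weak_div_def L2_def)
  have L: "\<tau> \<in> L2 (lebesgue_on K)" "\<tau>' \<in> L2 (lebesgue_on K)"
    using d d' by (auto simp: has_weak_div_def)
  have "has_bochner_integral (boundary_measure K) (\<lambda>x. g' x \<bullet> \<phi> x)
      (L2_inner (lebesgue_on K) d \<phi> + L2_inner (lebesgue_on K) \<tau>' (\<lambda>x. jacobian \<phi> (at x)))"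
    if \<phi>: "C_infinity \<phi>" for \<phi>
  proof -
    have j: "(\<lambda>x. jacobian \<phi> (at x)) \<in> L2 (lebesgue_on K)"
      by (intro continuous_in_L2 K continuous_on_jacobian \<phi>)
    have [measurable]: "\<phi> \<in> borel_measurable (boundary_measure K)" "g \<in> borel_measurable (boundary_measure K)"
      "g' \<in> borel_measurable (boundary_measure K)"
      using continuous_measurable_boundary_measure[OF C_infinity_continuous[OF \<phi>]] m(2) L2_measurable[OF gL]
      by auto
    have "has_bochner_integral (boundary_measure K) (\<lambda>x. g x \<bullet> \<phi> x) c
        = has_bochner_integral (boundary_measure K) (\<lambda>x. g' x \<bullet> \<phi> x) c" for c
      by (rule has_bochner_integral_cong_AE) (use ae(2) in auto)
    then show ?thesis
      using g[OF \<phi>] L2_inner_cong_AE[OF L j ae(1)] by simp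
  qed
  then show ?thesis
    unfolding has_normal_trace_altdef using d' L2_cong_AE[OF gL m(2) ae(2)] by blast
qed

lemma has_tr_lincomb:
  assumes K: "compact K" and "has_tr K \<tau> v \<mu>" "has_tr K \<tau>' v' \<mu>'"
  shows "has_tr K (\<lambda>x. a *\<^sub>R \<tau> x + b *\<^sub>R \<tau>' x) (\<lambda>x. a *\<^sub>R v x + b *\<^sub>R v' x)
     (\<lambda>x. a *\<^sub>R \<mu> x + b *\<^sub>R \<mu>' x)"
proof -
  obtain g h where 1: "has_normal_trace K \<tau> g" "has_trace K v h"
    and e: "AE x in boundary_measure K. \<mu> x = g x + h x"
    using assms(2) by (auto simp: has_tr_def)
  obtain g' h' where 2: "has_normal_trace K \<tau>' g'" "has_trace K v' h'"
    and e': "AE x in boundary_measure K. \<mu>' x = g' x + h' x"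
    using assms(3) by (auto simp: has_tr_def)
  have "AE x in boundary_measure K. a *\<^sub>R \<mu> x + b *\<^sub>R \<mu>' x
      = (a *\<^sub>R g x + b *\<^sub>R g' x) + (a *\<^sub>R h x + b *\<^sub>R h' x)"
    using e e' by eventually_elim (simp add: algebra_simps)
  moreover have "(\<lambda>x. a *\<^sub>R \<mu> x + b *\<^sub>R \<mu>' x) \<in> borel_measurable (boundary_measure K)"
    using assms(2,3) unfolding has_tr_def
    by (intro borel_measurable_add borel_measurable_scaleR) auto
  ultimately show ?thesis
    unfolding has_tr_def
    using has_normal_trace_lincomb[OF K 1(1) 2(1), of a b] has_trace_lincomb[OF K 1(2) 2(2), of a b]
    by blast
qed

text \<open>The Frobenius product does not change when both factors are transposed, so a symmetric
  matrix has the same product with \<open>G\<close> and with its transpose.\<close>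

lemma inner_symmetric_part:
  fixes A G :: "real ^ 'n ^ 'n"
  assumes "transpose A = A"
  shows "A \<bullet> ((1 / 2) *\<^sub>R (G + transpose G)) = A \<bullet> G"
proof -
  have "A \<bullet> transpose G = transpose A \<bullet> G"
    unfolding inner_vec_def transpose_def by (simp add: sum.swap[of "\<lambda>i j. A $ i $ j * G $ j $ i"])
  then show ?thesis
    using assms by (simp add: inner_add_right)
qed

text \<open>For smooth functions the identity is the definition of the normal trace. It passes to
  the limit along the sequence that defines the trace of \<open>v\<close>, and symmetry of
  \<open>\<tau>\<close> turns the gradient into the strain. One \<open>E\<close>, depending on
  \<open>v\<close> alone, serves all \<open>\<tau>\<close>.\<close>

lemma Green_formula:
  assumes K: "compact K" and v: "has_trace K v h"
  obtains E where "has_weak_strain K v E"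
    and "\<And>\<tau> g. has_normal_trace K \<tau> g \<Longrightarrow> AE x in lebesgue_on K. transpose (\<tau> x) = \<tau> x \<Longrightarrow>
      \<exists>d. has_weak_div K \<tau> d \<and>
        L2_inner (boundary_measure K) g h
          = L2_inner (lebesgue_on K) d v + L2_inner (lebesgue_on K) \<tau> E"
proof -
  obtain G \<phi> where G: "has_weak_gradient K v G" and \<phi>: "\<And>k. C_infinity (\<phi> k)"
    and lim: "L2_tendsto (lebesgue_on K) \<phi> v"
      "L2_tendsto (lebesgue_on K) (\<lambda>k x. jacobian (\<phi> k) (at x)) G"
      "L2_tendsto (boundary_measure K) \<phi> h"
    using v unfolding has_trace_def by blast
  define E where "E x = (1 / 2) *\<^sub>R (G x + transpose (G x))" for x
  have E: "has_weak_strain K v E"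
    using has_weak_strainI[OF G] by (simp add: E_def[abs_def])
  have L: "v \<in> L2 (lebesgue_on K)" "G \<in> L2 (lebesgue_on K)" "E \<in> L2 (lebesgue_on K)"
    "h \<in> L2 (boundary_measure K)"
    using G E v by (auto simp: has_weak_gradient_def has_weak_strain_def has_trace_def)
  have "\<exists>d. has_weak_div K \<tau> d \<and>
        L2_inner (boundary_measure K) g h
          = L2_inner (lebesgue_on K) d v + L2_inner (lebesgue_on K) \<tau> E"
    if \<tau>: "has_normal_trace K \<tau> g" and sym: "AE x in lebesgue_on K. transpose (\<tau> x) = \<tau> x" for \<tau> g
  proof -
    obtain d where d: "has_weak_div K \<tau> d" and g: "\<And>\<phi>. C_infinity \<phi> \<Longrightarrow>
           has_bochner_integral (boundary_measure K) (\<lambda>x. g x \<bullet> \<phi> x)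
             (L2_inner (lebesgue_on K) d \<phi> + L2_inner (lebesgue_on K) \<tau> (\<lambda>x. jacobian \<phi> (at x)))"
      using \<tau> by (auto simp: has_normal_trace_altdef)
    have L': "g \<in> L2 (boundary_measure K)" "d \<in> L2 (lebesgue_on K)" "\<tau> \<in> L2 (lebesgue_on K)"
      using \<tau> d by (auto simp: has_normal_trace_def has_weak_div_def)
    have mK: "f \<in> borel_measurable (lebesgue_on K)"
      if "continuous_on UNIV f" for f :: "real ^ 'a \<Rightarrow> 'b::euclidean_space"
      using continuous_in_L2[OF K that] by (rule L2_measurable)
    have "(\<lambda>k. L2_inner (boundary_measure K) g (\<phi> k)) \<longlonglongrightarrow> L2_inner (boundary_measure K) g h"
      by (intro L2_tendsto_inner L L' lim continuous_measurable_boundary_measure C_infinity_continuous \<phi>)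
    moreover have "(\<lambda>k. L2_inner (lebesgue_on K) d (\<phi> k)
          + L2_inner (lebesgue_on K) \<tau> (\<lambda>x. jacobian (\<phi> k) (at x)))
        \<longlonglongrightarrow> L2_inner (lebesgue_on K) d v + L2_inner (lebesgue_on K) \<tau> G"
      by (intro tendsto_add L2_tendsto_inner L L' lim mK C_infinity_continuous continuous_on_jacobian \<phi>)
    moreover have "L2_inner (boundary_measure K) g (\<phi> k) = L2_inner (lebesgue_on K) d (\<phi> k)
          + L2_inner (lebesgue_on K) \<tau> (\<lambda>x. jacobian (\<phi> k) (at x))" for k
      using has_bochner_integral_integral_eq[OF g[OF \<phi>]] by (simp add: L2_inner_def)
    ultimately have "L2_inner (boundary_measure K) g h
        = L2_inner (lebesgue_on K) d v + L2_inner (lebesgue_on K) \<tau> G"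
      by (simp add: LIMSEQ_unique)
    moreover have "L2_inner (lebesgue_on K) \<tau> E = L2_inner (lebesgue_on K) \<tau> G"
      unfolding L2_inner_def
    proof (rule integral_cong_AE)
      show "AE x in lebesgue_on K. \<tau> x \<bullet> E x = \<tau> x \<bullet> G x"
        using sym by eventually_elim (simp only: E_def inner_symmetric_part)
    qed (use L2_integrable_inner[OF L'(3) L(3)] L2_integrable_inner[OF L'(3) L(2)] in auto)
    ultimately show ?thesis
      using d by auto
  qed
  with E that show thesis
    by blast
qed

section \<open>M-decompositions\<close>

lemma div_image_subspace:
  assumes K: "compact K" and \<Sigma>: "L2_subspace (lebesgue_on K) \<Sigma>"
    and div: "\<Sigma> \<subseteq> Hdiv_sym K"
  shows "L2_subspace (lebesgue_on K) (div_image K \<Sigma>)"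
proof (rule L2_subspaceI)
  show "div_image K \<Sigma> \<subseteq> L2 (lebesgue_on K)"
    by (auto simp: div_image_def has_weak_div_def)
  show lin: "(\<lambda>x. a *\<^sub>R f x + b *\<^sub>R g x) \<in> div_image K \<Sigma>"
    if "f \<in> div_image K \<Sigma>" "g \<in> div_image K \<Sigma>" for f g a b
    using that has_weak_div_lincomb[OF K] L2_subspace_lincomb[OF \<Sigma>] unfolding div_image_def by blast
  \<comment> \<open>Zero is reached from an arbitrary divergence by taking both coefficients 0,
    which is why \<open>lin\<close> is proved first.\<close>
  obtain d where "d \<in> div_image K \<Sigma>"
    using L2_subspace_zero[OF \<Sigma>] div unfolding div_image_def Hdiv_sym_def by blast
  from lin[OF this this, of 0 0] show "(\<lambda>x. 0) \<in> div_image K \<Sigma>"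
    by simp
  show "g \<in> div_image K \<Sigma>"
    if "f \<in> div_image K \<Sigma>" "g \<in> borel_measurable (lebesgue_on K)" "AE x in lebesgue_on K. f x = g x" for f g
  proof -
    obtain \<tau> where \<tau>: "\<tau> \<in> \<Sigma>" "has_weak_div K \<tau> f"
      using \<open>f \<in> div_image K \<Sigma>\<close> by (auto simp: div_image_def)
    have "has_weak_div K \<tau> g"
      by (rule has_weak_div_cong_AE[OF K \<tau>(2) _ that(2) _ that(3)])
        (use \<tau> in \<open>auto simp: has_weak_div_def L2_def\<close>)
    with \<tau> show ?thesis
      by (auto simp: div_image_def)
  qed
qed

lemma strain_image_subspace:
  assumes K: "compact K" and V: "L2_subspace (lebesgue_on K) V" and H1: "V \<subseteq> H1 K"
  shows "L2_subspace (lebesgue_on K) (strain_image K V)"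
proof (rule L2_subspaceI)
  show "strain_image K V \<subseteq> L2 (lebesgue_on K)"
    by (auto simp: strain_image_def has_weak_strain_def)
  show lin: "(\<lambda>x. a *\<^sub>R f x + b *\<^sub>R g x) \<in> strain_image K V"
    if "f \<in> strain_image K V" "g \<in> strain_image K V" for f g a b
    using that has_weak_strain_lincomb[OF K] L2_subspace_lincomb[OF V] unfolding strain_image_def by blast
  obtain E where "E \<in> strain_image K V"
    using L2_subspace_zero[OF V] H1 has_weak_strainI unfolding strain_image_def H1_def by blast
  from lin[OF this this, of 0 0] show "(\<lambda>x. 0) \<in> strain_image K V"
    by simp
  show "g \<in> strain_image K V"
    if "f \<in> strain_image K V" "g \<in> borel_measurable (lebesgue_on K)" "AE x in lebesgue_on K. f x = g x" for f g
    using that has_weak_strain_cong_AE unfolding strain_image_def by blast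
qed

theorem proposition3p4:
  fixes K :: "(real ^ 'n) set"
    and \<Sigma>g :: "(real ^ 'n \<Rightarrow> real ^ 'n ^ 'n) set"
    and Vg :: "(real ^ 'n \<Rightarrow> real ^ 'n) set"
    and M :: "(real ^ 'n \<Rightarrow> real ^ 'n) set"
  assumes "CARD('n) = 2 \<or> CARD('n) = 3"
    and "polyhedral_element K"
    and "stress_space K \<Sigma>g"
    and "displacement_space K Vg"
    and "trace_space K M"
    and "admits_M_decomposition K M \<Sigma>g Vg"
    and "rigid_motions K \<subseteq> div_image K \<Sigma>g"
  shows "admits_M_decomposition K M \<Sigma>g (div_image K \<Sigma>g)"
proof -
  let ?L = "lebesgue_on K" and ?B = "boundary_measure K"
  have K: "compact K"
    using assms(2) by (rule polyhedral_element_compact)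
  have \<Sigma>: "L2_subspace ?L \<Sigma>g" "L2_finite_dim ?L \<Sigma>g" "\<Sigma>g \<subseteq> Hdiv_sym K"
    and normal: "\<And>\<tau>. \<tau> \<in> \<Sigma>g \<Longrightarrow> \<exists>g. has_normal_trace K \<tau> g"
    using assms(3) by (auto simp: stress_space_def)
  have \<Sigma>L: "\<Sigma>g \<subseteq> L2 ?L"
    using \<Sigma>(1) by (simp add: L2_subspace_def)
  have sym: "AE x in ?L. transpose (\<tau> x) = \<tau> x" if "\<tau> \<in> \<Sigma>g" for \<tau>
    using \<Sigma>(3) that by (auto simp: Hdiv_sym_def)
  have V: "L2_subspace ?L Vg" "Vg \<subseteq> H1 K"
    using assms(4) by (auto simp: displacement_space_def)
  have M: "L2_subspace ?B M" "L2_finite_dim ?B M"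
    using assms(5) by (auto simp: trace_space_def)
  have M_L2: "M \<subseteq> L2 ?B"
    using M(1) by (simp add: L2_subspace_def)
  obtain \<Sigma>t Vt where
    tr_ex: "\<And>\<tau> v. \<tau> \<in> \<Sigma>g \<Longrightarrow> v \<in> Vg \<Longrightarrow> \<exists>\<mu>. has_tr K \<tau> v \<mu>"
    and tr_M: "\<And>\<tau> v \<mu>. \<tau> \<in> \<Sigma>g \<Longrightarrow> v \<in> Vg \<Longrightarrow> has_tr K \<tau> v \<mu> \<Longrightarrow> \<mu> \<in> M"
    and \<Sigma>t: "L2_subspace ?L \<Sigma>t" "\<Sigma>t \<subseteq> \<Sigma>g"
    and Vt: "L2_subspace ?L Vt" "Vt \<subseteq> Vg"
    and strain: "strain_image K Vg \<subseteq> \<Sigma>t" and div: "div_image K \<Sigma>g \<subseteq> Vt"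
    and iso: "tr_isomorphism K (L2_perp ?L \<Sigma>g \<Sigma>t) (L2_perp ?L Vg Vt) M"
    using assms(6) unfolding admits_M_decomposition_def by blast
  have VtL: "Vt \<subseteq> L2 ?L"
    using Vt(1) by (simp add: L2_subspace_def)
  have zero: "(\<lambda>x. 0) \<in> L2_perp ?L \<Sigma>g \<Sigma>t" "(\<lambda>x. 0) \<in> L2_perp ?L Vg Vt"
    using L2_subspace_zero[OF L2_subspace_perp[OF \<Sigma>(1), of \<Sigma>t]]
      L2_subspace_zero[OF L2_subspace_perp[OF V(1) VtL]] \<Sigma>t(2) \<Sigma>L by auto

  \<comment> \<open>Traces of the zero fields and uniqueness of traces\<close>
  have normal0: "has_normal_trace K (\<lambda>x. 0) (\<lambda>x. 0)"
  proof -
    obtain \<tau> g where "has_normal_trace K \<tau> g"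
      using normal L2_subspace_zero[OF \<Sigma>(1)] by blast
    from has_normal_trace_lincomb[OF K this this, of 0 0] show ?thesis
      by simp
  qed
  have trace0: "has_trace K (\<lambda>x. 0) (\<lambda>x. 0)"
  proof -
    obtain v h where "has_trace K v h"
      using tr_ex L2_subspace_zero[OF \<Sigma>(1)] L2_subspace_zero[OF V(1)] unfolding has_tr_def by blast
    from has_trace_lincomb[OF K this this, of 0 0] show ?thesis
      by simp
  qed
  have has_trI: "has_tr K \<tau> v (\<lambda>x. g x + h x)" if "has_normal_trace K \<tau> g" "has_trace K v h" for \<tau> v g h
    using that unfolding has_tr_def
    by (auto simp: has_normal_trace_def has_trace_def L2_def intro!: borel_measurable_add)
  \<comment> \<open>Uniqueness of traces is not proved from scratch: it is inherited from the given isomorphism,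
    which is single-valued at \<open>(0, 0)\<close>.\<close>
  have tr0_AE: "AE x in ?B. \<mu> x = 0" if "has_tr K (\<lambda>x. 0) (\<lambda>x. 0) \<mu>" for \<mu>
  proof -
    have "has_tr K (\<lambda>x. 0) (\<lambda>x. 0) (\<lambda>x. 0)"
      using has_trI[OF normal0 trace0] by simp
    with iso[unfolded tr_isomorphism_def, THEN conjunct2, THEN conjunct1, rule_format, OF zero that]
    show ?thesis
      by simp
  qed
  have normal0_AE: "AE x in ?B. g x = 0" if "has_normal_trace K (\<lambda>x. 0) g" for g
    using tr0_AE[OF has_trI[OF that trace0]] by simp
  have trace0_AE: "AE x in ?B. h x = 0" if "has_trace K (\<lambda>x. 0) h" for h
    using tr0_AE[OF has_trI[OF normal0 that]] by simp
  \<comment> \<open>A normal trace alone is the value of \<open>tr\<close> at a pair whose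
    displacement is zero.\<close>
  have normal_M: "g \<in> M" if "\<tau> \<in> \<Sigma>g" "has_normal_trace K \<tau> g" for \<tau> g
    using tr_M[OF that(1) L2_subspace_zero[OF V(1)]] has_trI[OF that(2) trace0] by simp
  \<comment> \<open>In contrast to \<open>trace0_AE\<close>, the field vanishes only almost
    everywhere here.\<close>
  have trace_0_AE: "AE x in ?B. h x = 0" if "has_trace K v h" "AE x in ?L. v x = 0" for v h
    using trace0_AE has_trace_cong_AE[OF K that(1) _ that(2)] by simp
  have normal_0_AE: "AE x in ?B. g x = 0" if "has_normal_trace K \<tau> g" "AE x in ?L. \<tau> x = 0" for \<tau> g
    using normal0_AE has_normal_trace_cong_AE[OF K that(1) _ _ that(2), of g]
      that(1) by (auto simp: has_normal_trace_def L2_def)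
  have normal_unique: "AE x in ?B. g x = g' x" if "has_normal_trace K \<tau> g" "has_normal_trace K \<tau> g'" for \<tau> g g'
    using normal0_AE[of "\<lambda>x. g x - g' x"] has_normal_trace_lincomb[OF K that, of 1 "-1"] by simp

  \<comment> \<open>The spaces of the new decomposition\<close>
  define V where "V = div_image K \<Sigma>g"
  define S where "S = strain_image K V"
  define A where "A = L2_perp ?L \<Sigma>g S"
  define Z where "Z = {\<tau>\<in>A. has_normal_trace K \<tau> (\<lambda>x. 0)}"
  \<comment> \<open>The sum of \<open>S\<close> and \<open>Z\<close>, written as the fields that
    differ from a strain by an element of \<open>Z\<close>. In this form closure under
    almost-everywhere equality is inherited from \<open>Z\<close>.\<close>
  define T where "T = {\<tau>\<in>\<Sigma>g. \<exists>e\<in>S. (\<lambda>x. \<tau> x - e x) \<in> Z}"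
  have VVt: "V \<subseteq> Vt" and VVg: "V \<subseteq> Vg"
    using div Vt(2) by (auto simp: V_def)
  have Vsub: "L2_subspace ?L V"
    unfolding V_def by (rule div_image_subspace[OF K \<Sigma>(1,3)])
  have VL: "V \<subseteq> L2 ?L"
    using Vsub by (simp add: L2_subspace_def)
  have Ssub: "L2_subspace ?L S"
    unfolding S_def by (rule strain_image_subspace[OF K Vsub]) (use VVg \<open>Vg \<subseteq> H1 K\<close> in auto)
  have S\<Sigma>t: "S \<subseteq> \<Sigma>t"
    using strain VVg by (auto simp: S_def strain_image_def)
  then have S\<Sigma>: "S \<subseteq> \<Sigma>g"
    using \<Sigma>t(2) by auto
  have SL: "S \<subseteq> L2 ?L"
    using S\<Sigma> \<Sigma>L by auto
  have Asub: "L2_subspace ?L A"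
    unfolding A_def by (rule L2_subspace_perp[OF \<Sigma>(1) SL])
  have A\<Sigma>: "A \<subseteq> \<Sigma>g"
    by (auto simp: A_def L2_perp_def)
  have Zsub: "L2_subspace ?L Z"
  proof (rule L2_subspaceI)
    show "Z \<subseteq> L2 ?L"
      using A\<Sigma> \<Sigma>L by (auto simp: Z_def)
    show "(\<lambda>x. 0) \<in> Z"
      using normal0 L2_subspace_zero[OF Asub] by (simp add: Z_def)
    show "(\<lambda>x. a *\<^sub>R f x + b *\<^sub>R g x) \<in> Z" if "f \<in> Z" "g \<in> Z" for f g a b
      using that has_normal_trace_lincomb[OF K, of f "\<lambda>x. 0" g "\<lambda>x. 0" a b]
        L2_subspace_lincomb[OF Asub, of f g a b] by (simp add: Z_def)
    show "g \<in> Z" if "f \<in> Z" "g \<in> borel_measurable ?L" "AE x in ?L. f x = g x" for f g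
      using that has_normal_trace_cong_AE[OF K, of f "\<lambda>x. 0" g "\<lambda>x. 0"]
        L2_subspace_cong_AE[OF Asub, of f g] by (simp add: Z_def)
  qed
  have Z\<Sigma>: "Z \<subseteq> \<Sigma>g"
    using A\<Sigma> by (auto simp: Z_def)
  have ZL: "Z \<subseteq> L2 ?L"
    using Z\<Sigma> \<Sigma>L by auto
  have T\<Sigma>: "T \<subseteq> \<Sigma>g"
    by (auto simp: T_def)
  have Tsub: "L2_subspace ?L T"
  proof (rule L2_subspaceI)
    show "T \<subseteq> L2 ?L"
      using T\<Sigma> \<Sigma>L by auto
    show "(\<lambda>x. 0) \<in> T"
      using L2_subspace_zero[OF \<Sigma>(1)] L2_subspace_zero[OF Zsub] L2_subspace_zero[OF Ssub]
      by (auto simp: T_def intro!: bexI[of _ "\<lambda>x. 0"])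
    show "(\<lambda>x. a *\<^sub>R f x + b *\<^sub>R g x) \<in> T" if fg: "f \<in> T" "g \<in> T" for f g a b
    proof -
      obtain e e' where e: "e \<in> S" "e' \<in> S" "(\<lambda>x. f x - e x) \<in> Z" "(\<lambda>x. g x - e' x) \<in> Z"
        using fg by (auto simp: T_def)
      have "(\<lambda>x. (a *\<^sub>R f x + b *\<^sub>R g x) - (a *\<^sub>R e x + b *\<^sub>R e' x)) \<in> Z"
        using L2_subspace_lincomb[OF Zsub e(3,4), of a b] by (simp add: algebra_simps)
      then show ?thesis
        using L2_subspace_lincomb[OF Ssub e(1,2), of a b] L2_subspace_lincomb[OF \<Sigma>(1), of f g a b] fg
        by (auto simp: T_def)
    qed
    show "g \<in> T" if fg: "f \<in> T" "g \<in> borel_measurable ?L" "AE x in ?L. f x = g x" for f g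
    proof -
      obtain e where e: "e \<in> S" "(\<lambda>x. f x - e x) \<in> Z"
        using fg by (auto simp: T_def)
      have g: "g \<in> \<Sigma>g"
        using L2_subspace_cong_AE[OF \<Sigma>(1) _ fg(2,3)] fg(1) T\<Sigma> by auto
      have "(\<lambda>x. g x - e x) \<in> Z"
      proof (rule L2_subspace_cong_AE[OF Zsub e(2)])
        show "(\<lambda>x. g x - e x) \<in> borel_measurable ?L"
          using g e(1) \<Sigma>L SL by (intro borel_measurable_diff L2_measurable) auto
        show "AE x in ?L. f x - e x = g x - e x"
          using fg(3) by eventually_elim simp
      qed
      then show ?thesis
        using g e(1) by (auto simp: T_def)
    qed
  qed
  \<comment> \<open>The complement of a sum is the intersection of the complements, and membership
    in \<open>A\<close> already expresses orthogonality to \<open>S\<close>.\<close>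
  have perp_T: "\<tau> \<in> L2_perp ?L \<Sigma>g T \<longleftrightarrow> \<tau> \<in> A \<and> (\<forall>z\<in>Z. L2_inner ?L \<tau> z = 0)" for \<tau>
  proof
    assume \<tau>: "\<tau> \<in> L2_perp ?L \<Sigma>g T"
    have "S \<subseteq> T"
      using S\<Sigma> L2_subspace_zero[OF Zsub] by (auto simp: T_def intro!: bexI)
    moreover have "Z \<subseteq> T"
      using Z\<Sigma> L2_subspace_zero[OF Ssub] by (auto simp: T_def intro!: bexI[of _ "\<lambda>x. 0"])
    ultimately show "\<tau> \<in> A \<and> (\<forall>z\<in>Z. L2_inner ?L \<tau> z = 0)"
      using \<tau> by (auto simp: L2_perp_def A_def)
  next
    assume \<tau>: "\<tau> \<in> A \<and> (\<forall>z\<in>Z. L2_inner ?L \<tau> z = 0)"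
    have "L2_inner ?L \<tau> t = 0" if t: "t \<in> T" for t
    proof -
      obtain e where e: "e \<in> S" "(\<lambda>x. t x - e x) \<in> Z"
        using t by (auto simp: T_def)
      have "L2_inner ?L (\<lambda>x. t x - e x) \<tau> = L2_inner ?L t \<tau> - L2_inner ?L e \<tau>"
        by (rule L2_inner_diff) (use t T\<Sigma> e(1) S\<Sigma> \<tau> A\<Sigma> \<Sigma>L in auto)
      then show ?thesis
        using \<tau> e by (auto simp: A_def L2_perp_def L2_inner_commute)
    qed
    then show "\<tau> \<in> L2_perp ?L \<Sigma>g T"
      using \<tau> by (auto simp: A_def L2_perp_def)
  qed
  have perp_V: "AE x in ?L. v x = 0" if "v \<in> L2_perp ?L V V" for v
    using that VL by (intro L2_inner_self_eq_0) (auto simp: L2_perp_def)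

  \<comment> \<open>The subspace of \<open>M\<close> formed by the normal traces of
    \<open>A\<close>\<close>
  define N where "N = {\<mu>\<in>M. \<exists>\<tau>\<in>A. has_normal_trace K \<tau> \<mu>}"
  have NM: "N \<subseteq> M"
    by (auto simp: N_def)
  have Nsub: "L2_subspace ?B N"
  proof (rule L2_subspaceI)
    show "N \<subseteq> L2 ?B"
      using NM M_L2 by auto
    show "(\<lambda>x. 0) \<in> N"
      using L2_subspace_zero[OF M(1)] L2_subspace_zero[OF Asub] normal0 by (auto simp: N_def)
    show "(\<lambda>x. a *\<^sub>R f x + b *\<^sub>R g x) \<in> N" if "f \<in> N" "g \<in> N" for f g a b
      using that L2_subspace_lincomb[OF M(1)] L2_subspace_lincomb[OF Asub] has_normal_trace_lincomb[OF K]
      unfolding N_def by blast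
    show "g \<in> N" if "f \<in> N" "g \<in> borel_measurable ?B" "AE x in ?B. f x = g x" for f g
    proof -
      obtain \<tau> where \<tau>: "\<tau> \<in> A" "has_normal_trace K \<tau> f"
        using \<open>f \<in> N\<close> by (auto simp: N_def)
      have "\<tau> \<in> borel_measurable ?L"
        using \<tau>(1) A\<Sigma> \<Sigma>L by (auto intro: L2_measurable)
      then have "has_normal_trace K \<tau> g"
        using has_normal_trace_cong_AE[OF K \<tau>(2) _ that(2) _ that(3)] by simp
      then show ?thesis
        using \<tau>(1) L2_subspace_cong_AE[OF M(1) _ that(2,3)] that(1) by (auto simp: N_def)
    qed
  qed

  \<comment> \<open>The normal traces of \<open>A\<close> fill \<open>M\<close>\<close>
  have "N = M"
  proof (rule L2_subspace_eqI[OF M Nsub NM])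
    fix m
    assume m: "m \<in> L2_perp ?B M N"
    then have mM: "m \<in> M" and m_L2: "m \<in> L2 ?B"
      using M_L2 by (auto simp: L2_perp_def)
    \<comment> \<open>The pairing of the normal trace of \<open>\<tau>\<close> with
      \<open>m\<close>. A normal trace is selected by choice to obtain a function of
      \<open>\<tau>\<close>; by \<open>normal_unique\<close> every other one gives the same
      value.\<close>
    define F where "F \<tau> = L2_inner ?B (SOME g. has_normal_trace K \<tau> g) m" for \<tau>
    have F: "F \<tau> = L2_inner ?B g m" if "has_normal_trace K \<tau> g" for \<tau> g
    proof -
      have s: "has_normal_trace K \<tau> (SOME g. has_normal_trace K \<tau> g)"
        using that by (rule someI[where P = "has_normal_trace K \<tau>"])
      show ?thesis
        unfolding F_def
        by (rule L2_inner_cong_AE[OF _ _ m_L2 normal_unique[OF s that]])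
          (use s that in \<open>auto simp: has_normal_trace_def\<close>)
    qed
    have "\<exists>e\<in>S. \<forall>\<tau>\<in>\<Sigma>g. F \<tau> = L2_inner ?L \<tau> e"
    proof (rule L2_riesz_perp[OF \<Sigma>(1,2) Ssub S\<Sigma>])
      show "\<exists>e\<in>S. \<forall>\<tau>\<in>\<Sigma>g. F \<tau> = L2_inner ?L \<tau> e"
        if "e \<in> S" "\<And>\<tau>. \<tau> \<in> \<Sigma>g \<Longrightarrow> F \<tau> = L2_inner ?L \<tau> e" for e
        using that by blast
      show "F (\<lambda>x. a *\<^sub>R f x + b *\<^sub>R g x) = a * F f + b * F g" if "f \<in> \<Sigma>g" "g \<in> \<Sigma>g" for f g a b
      proof -
        obtain p q where pq: "has_normal_trace K f p" "has_normal_trace K g q"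
          using normal \<open>f \<in> \<Sigma>g\<close> \<open>g \<in> \<Sigma>g\<close> by blast
        then show ?thesis
          using F[OF has_normal_trace_lincomb[OF K pq]] F[OF pq(1)] F[OF pq(2)] m_L2
          by (simp add: L2_inner_lincomb has_normal_trace_def)
      qed
      show "F f = 0" if f: "f \<in> \<Sigma>g" "AE x in ?L. f x = 0" for f
      proof -
        obtain p where p: "has_normal_trace K f p"
          using normal f by blast
        then show ?thesis
          using F[OF p] L2_inner_AE_0[OF _ m_L2 normal_0_AE[OF p f(2)]] by (simp add: has_normal_trace_def)
      qed
      \<comment> \<open>This is where orthogonality of \<open>m\<close> to \<open>N\<close> enters.
        It forces the representing element of \<open>F\<close> to be the strain of some
        \<open>u\<close> in \<open>V\<close>.\<close>
      show "F f = 0" if "f \<in> L2_perp ?L \<Sigma>g S" for f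
      proof -
        have f: "f \<in> A"
          using that by (simp add: A_def)
        obtain p where p: "has_normal_trace K f p"
          using normal f A\<Sigma> by blast
        then have "p \<in> N"
          using f A\<Sigma> normal_M by (auto simp: N_def)
        then show ?thesis
          using m F[OF p] by (auto simp: L2_perp_def L2_inner_commute)
      qed
    qed
    then obtain e where e: "e \<in> S" "\<And>\<tau>. \<tau> \<in> \<Sigma>g \<Longrightarrow> F \<tau> = L2_inner ?L \<tau> e"
      by blast
    obtain u where u: "u \<in> V" "has_weak_strain K u e"
      using e(1) by (auto simp: S_def strain_image_def)
    \<comment> \<open>The last conjunct of the given isomorphism is its surjectivity.\<close>
    obtain \<sigma> w where \<sigma>: "\<sigma> \<in> L2_perp ?L \<Sigma>g \<Sigma>t" and w: "w \<in> L2_perp ?L Vg Vt" and "has_tr K \<sigma> w m"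
      using iso[unfolded tr_isomorphism_def, THEN conjunct2, THEN conjunct2, THEN conjunct2, THEN conjunct2] mM
    by blast
    then obtain g h where g: "has_normal_trace K \<sigma> g" and h: "has_trace K w h"
      and mgh: "AE x in ?B. m x = g x + h x"
      unfolding has_tr_def by blast
    have \<sigma>\<Sigma>: "\<sigma> \<in> \<Sigma>g" and wV: "w \<in> Vg"
      using \<sigma> w by (auto simp: L2_perp_def)
    have L: "g \<in> L2 ?B" "h \<in> L2 ?B" "w \<in> L2 ?L"
      using g h by (auto simp: has_normal_trace_def has_trace_def has_weak_gradient_def)
    have mghL: "(\<lambda>x. 1 *\<^sub>R g x + 1 *\<^sub>R h x) \<in> L2 ?B"
      by (rule L2_lincomb[OF L(1,2)])
    obtain E where E: "has_weak_strain K w E" and Green: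
      "\<And>\<tau> g. has_normal_trace K \<tau> g \<Longrightarrow> AE x in ?L. transpose (\<tau> x) = \<tau> x \<Longrightarrow>
        \<exists>d. has_weak_div K \<tau> d \<and> L2_inner ?B g h = L2_inner ?L d w + L2_inner ?L \<tau> E"
      using Green_formula[OF K h] by blast
    have E\<Sigma>t: "E \<in> \<Sigma>t"
      using E wV strain by (auto simp: strain_image_def)
    \<comment> \<open>In Green's formula the volume term with the divergence drops out: the
      divergence lies in \<open>Vt\<close>, to which \<open>w\<close> is orthogonal.\<close>
    have Gw: "L2_inner ?B p h = L2_inner ?L \<tau> E" if \<tau>: "\<tau> \<in> \<Sigma>g" "has_normal_trace K \<tau> p" for \<tau> p
    proof -
      obtain d where d: "has_weak_div K \<tau> d" "L2_inner ?B p h = L2_inner ?L d w + L2_inner ?L \<tau> E"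
        using Green[OF \<tau>(2) sym[OF \<tau>(1)]] by blast
      have "d \<in> Vt"
        using d(1) \<tau>(1) div by (auto simp: div_image_def)
      then show ?thesis
        using d(2) w by (auto simp: L2_perp_def L2_inner_commute)
    qed
    \<comment> \<open>Both expressions equal the pairing of \<open>p\<close> with
      \<open>m = g + h\<close>: the left side by the choice of \<open>e\<close>, the right side by
      \<open>Gw\<close>.\<close>
    have Fgh: "L2_inner ?L \<tau> e = L2_inner ?B p g + L2_inner ?L \<tau> E"
      if \<tau>: "\<tau> \<in> \<Sigma>g" "has_normal_trace K \<tau> p" for \<tau> p
    proof -
      have pL: "p \<in> L2 ?B"
        using \<tau> by (simp add: has_normal_trace_def)
      have "L2_inner ?B m p = L2_inner ?B (\<lambda>x. 1 *\<^sub>R g x + 1 *\<^sub>R h x) p"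
        by (rule L2_inner_cong_AE[OF m_L2 mghL pL]) (use mgh in simp)
      also have "\<dots> = L2_inner ?B g p + L2_inner ?B h p"
        using L2_inner_lincomb[OF L(1,2) pL, of 1 1] by simp
      finally show ?thesis
        using e(2)[OF \<tau>(1)] F[OF \<tau>(2)] Gw[OF \<tau>] by (simp add: L2_inner_commute)
    qed
    \<comment> \<open>Take \<open>\<tau> = \<sigma>\<close> and \<open>p = g\<close>. Both
      \<open>e\<close> and \<open>E\<close> are in \<open>\<Sigma>t\<close>, to which
      \<open>\<sigma>\<close> is orthogonal, so only the boundary term remains.\<close>
    have "L2_inner ?B g g = 0"
      using Fgh[OF \<sigma>\<Sigma> g] \<sigma> E\<Sigma>t e(1) S\<Sigma>t by (auto simp: L2_perp_def)
    then have g0: "AE x in ?B. g x = 0"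
      by (rule L2_inner_self_eq_0[OF L(1)])
    have eE: "(\<lambda>x. e x - E x) \<in> \<Sigma>g"
      using L2_subspace_diff[OF \<Sigma>(1)] e(1) S\<Sigma> E\<Sigma>t \<Sigma>t(2) by blast
    \<comment> \<open>With \<open>g = 0\<close>, the identity \<open>Fgh\<close> makes
      \<open>e - E\<close> orthogonal to all of \<open>\<Sigma>g\<close>, which contains
      \<open>e - E\<close> itself.\<close>
    have "AE x in ?L. e x - E x = 0"
    proof (rule L2_inner_self_eq_0)
      show eEL: "(\<lambda>x. e x - E x) \<in> L2 ?L"
        using eE \<Sigma>L by auto
      obtain p where p: "has_normal_trace K (\<lambda>x. e x - E x) p"
        using normal[OF eE] by blast
      have "L2_inner ?B p g = 0"
        using p L2_inner_AE_0[OF L(1) _ g0, of p] by (simp add: has_normal_trace_def L2_inner_commute)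
      then have "L2_inner ?L (\<lambda>x. e x - E x) e = L2_inner ?L (\<lambda>x. e x - E x) E"
        using Fgh[OF eE p] by simp
      moreover have "L2_inner ?L (\<lambda>x. e x - E x) (\<lambda>x. e x - E x)
          = L2_inner ?L e (\<lambda>x. e x - E x) - L2_inner ?L E (\<lambda>x. e x - E x)"
        by (rule L2_inner_diff) (use eEL e(1) SL E\<Sigma>t \<Sigma>t(2) \<Sigma>L in auto)
      ultimately show "L2_inner ?L (\<lambda>x. e x - E x) (\<lambda>x. e x - E x) = 0"
        by (simp add: L2_inner_commute)
    qed
    then have "has_weak_strain K (\<lambda>x. 1 *\<^sub>R w x + (-1) *\<^sub>R u x) (\<lambda>x. 0)"
      by (intro has_weak_strain_cong_AE[OF has_weak_strain_lincomb[OF K E u(2)]]) auto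
    then have "(\<lambda>x. w x - u x) \<in> rigid_motions K"
      by (auto simp: rigid_motions_def H1_def has_weak_strain_def)
    \<comment> \<open>The hypothesis on rigid motions is used here.\<close>
    then have "(\<lambda>x. w x - u x) \<in> V"
      using assms(7) by (auto simp: V_def)
    then have "w \<in> V"
      using L2_subspace_lincomb[OF Vsub _ u(1), of "\<lambda>x. w x - u x" 1 1] by simp
    \<comment> \<open>Now \<open>w\<close> belongs to \<open>V\<close>, hence to \<open>Vt\<close>,
      and it is also orthogonal to \<open>Vt\<close>.\<close>
    then have "L2_inner ?L w w = 0"
      using w VVt by (auto simp: L2_perp_def)
    then have "AE x in ?B. h x = 0"
      using L2_inner_self_eq_0[OF L(3)] trace_0_AE[OF h] by blast
    with mgh g0 show "AE x in ?B. m x = 0"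
      by eventually_elim simp
  qed

  \<comment> \<open>The trace isomorphism of the new decomposition\<close>
  have "tr_isomorphism K (L2_perp ?L \<Sigma>g T) (L2_perp ?L V V) M"
    unfolding tr_isomorphism_def
  proof (intro conjI ballI allI impI)
    fix \<tau> v
    assume \<tau>: "\<tau> \<in> L2_perp ?L \<Sigma>g T" and v: "v \<in> L2_perp ?L V V"
    have \<tau>\<Sigma>: "\<tau> \<in> \<Sigma>g" and vV: "v \<in> Vg"
      using \<tau> v VVg by (auto simp: L2_perp_def)
    show "\<exists>\<mu>\<in>M. has_tr K \<tau> v \<mu>"
      using tr_ex[OF \<tau>\<Sigma> vV] tr_M[OF \<tau>\<Sigma> vV] by blast
    show "AE x in ?B. \<mu> x = \<mu>' x" if "has_tr K \<tau> v \<mu>" "has_tr K \<tau> v \<mu>'" for \<mu> \<mu>'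
      using tr0_AE[of "\<lambda>x. \<mu> x - \<mu>' x"] has_tr_lincomb[OF K that, of 1 "-1"] by simp
    fix \<tau>' v'
    assume \<tau>': "\<tau>' \<in> L2_perp ?L \<Sigma>g T" and v': "v' \<in> L2_perp ?L V V"
    show "has_tr K (\<lambda>x. a *\<^sub>R \<tau> x + b *\<^sub>R \<tau>' x) (\<lambda>x. a *\<^sub>R v x + b *\<^sub>R v' x) (\<lambda>x. a *\<^sub>R \<mu> x + b *\<^sub>R \<mu>' x)"
      if "has_tr K \<tau> v \<mu>" "has_tr K \<tau>' v' \<mu>'" for \<mu> \<mu>' a b
      by (rule has_tr_lincomb[OF K that])
    fix \<mu>
    assume \<mu>: "has_tr K \<tau> v \<mu>" and \<mu>': "has_tr K \<tau>' v' \<mu>"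
    show "AE x in ?L. v x = v' x"
      using perp_V[OF v] perp_V[OF v'] by eventually_elim simp
    obtain g h where g: "has_normal_trace K \<tau> g" "has_trace K v h" "AE x in ?B. \<mu> x = g x + h x"
      using \<mu> unfolding has_tr_def by blast
    obtain g' h' where g': "has_normal_trace K \<tau>' g'" "has_trace K v' h'" "AE x in ?B. \<mu> x = g' x + h' x"
      using \<mu>' unfolding has_tr_def by blast
    \<comment> \<open>Both displacements vanish almost everywhere, and so do their traces; the
      normal traces must therefore agree. It follows that \<open>\<tau> - \<tau>'\<close> lies in
      \<open>Z\<close> and is orthogonal to \<open>Z\<close>.\<close>
    have gg: "AE x in ?B. g x - g' x = 0"
      using g(3) g'(3) trace_0_AE[OF g(2) perp_V[OF v]] trace_0_AE[OF g'(2) perp_V[OF v']]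
      by eventually_elim simp
    have \<delta>: "(\<lambda>x. \<tau> x - \<tau>' x) \<in> L2_perp ?L \<Sigma>g T"
      using L2_subspace_diff[OF L2_subspace_perp[OF \<Sigma>(1)] \<tau> \<tau>'] T\<Sigma> \<Sigma>L by auto
    then have \<delta>L: "(\<lambda>x. \<tau> x - \<tau>' x) \<in> L2 ?L"
      using \<Sigma>L by (auto simp: L2_perp_def)
    have "has_normal_trace K (\<lambda>x. \<tau> x - \<tau>' x) (\<lambda>x. g x - g' x)"
      using has_normal_trace_lincomb[OF K g(1) g'(1), of 1 "-1"] by simp
    then have "has_normal_trace K (\<lambda>x. \<tau> x - \<tau>' x) (\<lambda>x. 0)"
      by (rule has_normal_trace_cong_AE[OF K _ L2_measurable[OF \<delta>L] _ _ gg]) auto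
    then have "(\<lambda>x. \<tau> x - \<tau>' x) \<in> Z"
      using \<delta> by (simp add: Z_def perp_T)
    then have "L2_inner ?L (\<lambda>x. \<tau> x - \<tau>' x) (\<lambda>x. \<tau> x - \<tau>' x) = 0"
      using \<delta> by (simp add: perp_T)
    then show "AE x in ?L. \<tau> x = \<tau>' x"
      using L2_inner_self_eq_0[OF \<delta>L] by simp
  next
    fix \<mu>
    assume "\<mu> \<in> M"
    then obtain \<tau> where \<tau>: "\<tau> \<in> A" "has_normal_trace K \<tau> \<mu>"
      using \<open>N = M\<close> by (auto simp: N_def)
    \<comment> \<open>Subtracting the projection onto \<open>Z\<close> makes \<open>\<tau>\<close>
      orthogonal to \<open>Z\<close> and leaves its normal trace unchanged.\<close>
    obtain p where p: "p \<in> Z" "\<And>z. z \<in> Z \<Longrightarrow> L2_inner ?L (\<lambda>x. \<tau> x - p x) z = 0"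
      using L2_projection[OF \<Sigma>(1,2) Zsub Z\<Sigma>, of \<tau>] \<tau>(1) A\<Sigma> \<Sigma>L by blast
    have "(\<lambda>x. \<tau> x - p x) \<in> L2_perp ?L \<Sigma>g T"
      using p L2_subspace_diff[OF Asub \<tau>(1), of p] by (simp add: perp_T Z_def)
    moreover have "has_normal_trace K (\<lambda>x. \<tau> x - p x) \<mu>"
      using has_normal_trace_lincomb[OF K \<tau>(2), of p "\<lambda>x. 0" 1 "-1"] p(1) by (simp add: Z_def)
    then have "has_tr K (\<lambda>x. \<tau> x - p x) (\<lambda>x. 0) \<mu>"
      using has_trI[OF _ trace0] by fastforce
    moreover have "(\<lambda>x. 0) \<in> L2_perp ?L V V"
      by (rule L2_subspace_zero[OF L2_subspace_perp[OF Vsub VL]])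
    ultimately show "\<exists>\<tau>\<in>L2_perp ?L \<Sigma>g T. \<exists>v\<in>L2_perp ?L V V. has_tr K \<tau> v \<mu>"
      by blast
  qed
  \<comment> \<open>A strain belongs to \<open>T\<close> with itself as \<open>e\<close>, the
    remainder being the zero element of \<open>Z\<close>.\<close>
  moreover have "strain_image K V \<subseteq> T"
    using S\<Sigma> L2_subspace_zero[OF Zsub] by (auto simp: T_def S_def[symmetric] intro!: bexI)
  ultimately show ?thesis
    unfolding admits_M_decomposition_def V_def[symmetric]
    using tr_ex tr_M VVg Tsub T\<Sigma> Vsub by (intro conjI exI[of _ T] exI[of _ V]) blast+
qed

end
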